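(* Let $V$ be a finite dimensional real or complex vector space, and let $G^*$ be an abelian subgroup of $GL(V)$ which has an orbit in $V$ with an inner point. Let $G$ be the Zariski closure of $G^*$, and let $G^0$ be the connected component of the identity of $G$. Then the following claims hold: (1) The group $G^*$ is an open subgroup of $G$ and contains $G^0$. (2) There is only a finite set of maximal $G^0$-invariant vector subspaces of $V$. They are also $G$-invariant. These are of real codimension $1$ or $2$ in $V$. Let $H_1,\ldots,H_r$ be those of codimension $1$ and $H_{r+1},\ldots,H_d$ be those of codimension $2$. We have $$r+2(d-r)\leq \dim_{\mathbb{R}} V.$$ (3) Let $U$ be the complement of $\bigcup_{i=1}^d H_i$ in $V$ and let $v$ be a point of $U$. Then the map $G\to U$, $g\mapsto gv$, is an analytic diffeomorphism. (4) The quotient group $G/G^0$ is isomorphic to $(\mathbb{Z}/2\mathbb{Z})^r$. For $v\in U$ the orbit $G^0v$ is the connected component of $v$ in $U$. The closure of $G^0v$ is the intersection of $r$ half spaces: namely, for each $i=1,\ldots,r$ there is exactly one open half space defined by $H_i$ which contains $v$, say $C_i$, and then $\overline{G^0v}=\bigcap_{i=1}^r \overline{C_i}$. (5) If $V$ has a structure as complex vector space such that every $h\in G^*$ is complex linear, then $r=0$, $G$ is connected and hence $G^0=G^*=G$. Then $U$ is the only open $G^*$-orbit and thus it is dense in $V$.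
   Context: All topological notions (open, closure, inner point, connected component, dense) refer to the Euclidean topology unless "Zariski" is explicitly mentioned. The Zariski closure $G$ of $G^*$ is its Zariski closure in $GL(V)$ as a real linear algebraic group (if $V$ is complex it is regarded as a real vector space). "Maximal $G^0$-invariant vector subspace" means maximal among the proper $G^0$-invariant real vector subspaces of $V$. The open half spaces defined by a real hyperplane $H_i$ are the two connected components of $V\setminus H_i$; an empty intersection (case $r=0$) is $V$. *)

theory Defs
  imports
    "HOL-Analysis.Analysis"
    "HOL-Algebra.Elementary_Groups"
    "HOL-Algebra.Product_Groups"
begin

text \<open>
  A finite-dimensional real vector space is a type of class \<^class>\<open>real_normed_vector\<close> that is
  spanned by a finite set. All norms on such a space induce the Euclidean topology, and the same
  holds for its space of endomorphisms, on which every linear map is bounded; so the norms only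
  serve to name that topology. In contrast to \<^class>\<open>euclidean_space\<close>, dimension zero is allowed.
\<close>

definition GL :: "('a::real_normed_vector \<Rightarrow>\<^sub>L 'a) monoid" where
  "GL = \<lparr>carrier = {g. bij (blinfun_apply g)}, mult = (o\<^sub>L), one = id_blinfun\<rparr>"

definition orbit :: "('a::real_normed_vector \<Rightarrow>\<^sub>L 'a) set \<Rightarrow> 'a \<Rightarrow> 'a set" where
  "orbit G v = (\<lambda>g. blinfun_apply g v) ` G"

text \<open>
  The regular functions on \<^const>\<open>GL\<close> are quotients of a polynomial in the matrix entries by a power
  of the determinant; the denominators are units and do not contribute new zero sets.
\<close>

definition zariski_closed_in_GL :: "('a::real_normed_vector \<Rightarrow>\<^sub>L 'a) set \<Rightarrow> bool" where
  "zariski_closed_in_GL Z \<longleftrightarrow>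
    (\<exists>P. (\<forall>p\<in>P. real_polynomial_function p) \<and> Z = {g \<in> carrier GL. \<forall>p\<in>P. p g = 0})"

definition zariski_closure ::
    "('a::real_normed_vector \<Rightarrow>\<^sub>L 'a) set \<Rightarrow> ('a \<Rightarrow>\<^sub>L 'a) set" where
  "zariski_closure S = zariski_closed_in_GL hull S"

definition invariant_subspace :: "('a::real_normed_vector \<Rightarrow>\<^sub>L 'a) set \<Rightarrow> 'a set \<Rightarrow> bool" where
  "invariant_subspace G W \<longleftrightarrow> subspace W \<and> (\<forall>g\<in>G. blinfun_apply g ` W \<subseteq> W)"

definition maximal_invariant_subspace ::
    "('a::real_normed_vector \<Rightarrow>\<^sub>L 'a) set \<Rightarrow> 'a set \<Rightarrow> bool" where
  "maximal_invariant_subspace G W \<longleftrightarrow>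
    invariant_subspace G W \<and> W \<noteq> UNIV \<and>
    (\<forall>W'. invariant_subspace G W' \<and> W' \<noteq> UNIV \<and> W \<subseteq> W' \<longrightarrow> W' = W)"

definition codim :: "'a::real_vector set \<Rightarrow> nat" where
  "codim W = dim (UNIV :: 'a set) - dim W"

definition open_half_spaces :: "'a::real_normed_vector set \<Rightarrow> 'a set set" where
  "open_half_spaces H = components (- H)"

text \<open>
  Near \<open>x\<close> the function is the sum of a power series in the coordinates \<open>t\<close> with respect to some
  basis \<open>B\<close> of the (finite-dimensional) domain; the multi-indices \<open>\<alpha>\<close> range over all functions
  from \<open>B\<close> to the natural numbers, and convergence is unconditional.
\<close>

definition real_analytic_at ::
    "('a::real_normed_vector \<Rightarrow> 'b::real_normed_vector) \<Rightarrow> 'a \<Rightarrow> bool" where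
  "real_analytic_at f x \<longleftrightarrow>
    (\<exists>B c r. finite B \<and> independent B \<and> span B = UNIV \<and> 0 < (r::real) \<and>
      (\<forall>t. (\<forall>b\<in>B. \<bar>t b\<bar> < r) \<longrightarrow>
        ((\<lambda>\<alpha>. (\<Prod>b\<in>B. t b ^ \<alpha> b) *\<^sub>R c \<alpha>) has_sum f (x + (\<Sum>b\<in>B. t b *\<^sub>R b)))
          (B \<rightarrow>\<^sub>E (UNIV :: nat set))))"

text \<open>
  On a set that need not be open, a map is analytic if it extends locally to an analytic map of the
  ambient spaces; for embedded analytic submanifolds (such as Zariski closed linear groups and open
  sets) this is analyticity in the intrinsic sense.
\<close>

definition real_analytic_on ::
    "('a::real_normed_vector \<Rightarrow> 'b::real_normed_vector) \<Rightarrow> 'a set \<Rightarrow> bool" where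
  "real_analytic_on f S \<longleftrightarrow>
    (\<forall>x\<in>S. \<exists>T F. open T \<and> x \<in> T \<and> (\<forall>y\<in>T. real_analytic_at F y) \<and> (\<forall>y\<in>S \<inter> T. F y = f y))"

definition analytic_diffeomorphism ::
    "('a::real_normed_vector \<Rightarrow> 'b::real_normed_vector) \<Rightarrow> 'a set \<Rightarrow> 'b set \<Rightarrow> bool" where
  "analytic_diffeomorphism f S T \<longleftrightarrow>
    bij_betw f S T \<and> real_analytic_on f S \<and> real_analytic_on (inv_into S f) T"

text \<open>A complex structure has to extend the given real scalar multiplication.\<close>

definition complex_structure :: "(complex \<Rightarrow> 'a::real_vector \<Rightarrow> 'a) \<Rightarrow> bool" where
  "complex_structure sc \<longleftrightarrow> vector_space sc \<and> (\<forall>r x. sc (complex_of_real r) x = r *\<^sub>R x)"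

end

theory Submission
  imports Defs "HOL-Computational_Algebra.Fundamental_Theorem_Algebra"
begin

text \<open>
  Let \<open>e\<close> be a vector whose orbit has an inner point. Then this orbit spans \<open>V\<close>, so an endomorphism
  commuting with the abelian group \<open>Gs\<close> is determined by its value at \<open>e\<close>, and every vector is the
  value at \<open>e\<close> of some element of the linear span of \<open>Gs\<close>. Hence the span of \<open>Gs\<close> is its own
  centralizer, evaluation at \<open>e\<close> identifies it with \<open>V\<close>, and \<open>V\<close> becomes a commutative real algebra
  with unit \<open>e\<close> on which the elements of the span act as multiplications. Everything in the theorem
  is then read off from this algebra.

  The group \<open>Gs\<close> corresponds to a subgroup of the unit group with an inner point, that is, to an
  open subgroup. A polynomial function vanishing on a nonempty open set vanishes everywhere, while the
  multiplications are cut out by linear equations; so the Zariski closure \<open>G\<close> is the whole unit group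
  (\<open>zariski_closure_Gs\<close>). Since an open set spans \<open>V\<close>, the subspaces invariant under \<open>G\<close>, or only under
  its identity component, are the ideals. The orbit map of a unit \<open>v\<close> is multiplication by \<open>v\<close>; it and
  its inverse are restrictions of linear maps, which makes it an analytic diffeomorphism.

  The maximal ideals \<open>M\<close> are controlled by their residue fields. A polynomial of least degree that
  annihilates \<open>a\<close> modulo \<open>M\<close> has degree at most two, since \<open>M\<close> is prime and real polynomials split into
  factors of such degree; it follows that \<open>M\<close> is the kernel of a character \<open>chi M\<close> onto the reals or onto the complex numbers
  (\<open>character_exists\<close>). So \<open>M\<close> has codimension one or two. Distinct maximal ideals are comaximal,
  hence their codimensions add up (\<open>sum_codim_maximal\<close>) and characters take prescribed values
  simultaneously (\<open>simultaneous_character_values\<close>).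

  A vector is a unit iff no character vanishes on it. The only obstruction to joining two units by a
  path of units is the sign of a real character: a complex character can be steered around zero by a
  detour through one intermediate point, and the detours for different maximal ideals can be chosen
  independently (\<open>connected_sign_class\<close>). So the components of the unit group are the classes of equal
  signs, which form a group \<open>(Z/2)^r\<close>, and their closures are given by the weak sign conditions. A
  complex structure commuting with \<open>Gs\<close> is multiplication by a square root of \<open>-1\<close>, which excludes
  real characters, and then the unit group is connected.
\<close>

section \<open>Finite-dimensional normed spaces\<close>

text \<open>
  The dimension is finite but the type is not in a class that provides a basis, so one is
  carried as a parameter; this gives access to the dimension theory of
  \<^locale>\<open>finite_dimensional_vector_space\<close>.
\<close>

locale findim_space =
  fixes B :: "'a::real_normed_vector set"
  assumes finite_B: "finite B" and independent_B: "independent B" and span_B: "span B = UNIV"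

sublocale findim_space \<subseteq> fd: finite_dimensional_vector_space "scaleR :: real \<Rightarrow> 'a \<Rightarrow> 'a" B
  rewrites "module.dependent (*\<^sub>R) = (dependent :: 'a set \<Rightarrow> bool)"
    and "module.representation (*\<^sub>R) = (representation :: 'a set \<Rightarrow> _)"
    and "module.subspace (*\<^sub>R) = (subspace :: 'a set \<Rightarrow> bool)"
    and "module.span (*\<^sub>R) = (span :: 'a set \<Rightarrow> _)"
    and "vector_space.dim (*\<^sub>R) = (dim :: 'a set \<Rightarrow> nat)"
proof -
  show "finite_dimensional_vector_space (scaleR :: real \<Rightarrow> 'a \<Rightarrow> 'a) B"
    by unfold_locales (use finite_B independent_B span_B in
        \<open>auto simp: dependent_raw_def span_raw_def\<close>)
qed (auto simp add: dependent_raw_def representation_raw_def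
      subspace_raw_def span_raw_def dim_raw_def)

lemma findim_spaceE:
  assumes "\<exists>B::'a::real_normed_vector set. finite B \<and> span B = UNIV"
  obtains B :: "'a::real_normed_vector set" where "findim_space B"
proof -
  obtain C :: "'a set" where C: "finite C" "span C = UNIV"
    using assms by blast
  obtain B where B: "B \<subseteq> C" "independent B" "C \<subseteq> span B"
    using maximal_independent_subset[of C] by blast
  have "span B = UNIV"
    using span_mono[OF B(3)] C(2) by (auto simp: span_span)
  then show thesis
    using that B(2) finite_subset[OF B(1) C(1)] by (simp add: findim_space_def)
qed

text \<open>
  The bound makes the coordinate sequences of a convergent sequence in the span Cauchy, and the limits
  of the coordinates represent the limit of the sequence.
\<close>

lemma closed_span_if_coordinates_bounded:
  fixes B :: "'a::real_normed_vector set"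
  assumes fin: "finite B"
    and bd: "\<And>t. (\<Sum>b\<in>B. \<bar>t b\<bar>) \<le> c * norm (\<Sum>b\<in>B. t b *\<^sub>R b)"
  shows "closed (span B)"
  unfolding closed_sequential_limits
proof (intro allI impI, elim conjE)
  fix x l assume x: "\<forall>n. x n \<in> span B" and l: "x \<longlonglongrightarrow> l"
  have "\<forall>n. \<exists>t. x n = (\<Sum>b\<in>B. t b *\<^sub>R b)"
    using x by (auto simp: span_finite[OF fin])
  then obtain t where t: "\<And>n. x n = (\<Sum>b\<in>B. t n b *\<^sub>R b)"
    by metis
  have diff: "\<bar>t m b - t n b\<bar> \<le> c * norm (x m - x n)" if "b \<in> B" for m n b
  proof -
    have "\<bar>t m b - t n b\<bar> \<le> (\<Sum>b\<in>B. \<bar>t m b - t n b\<bar>)"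
      by (rule member_le_sum) (use fin that in auto)
    also have "\<dots> \<le> c * norm (x m - x n)"
      using bd[of "\<lambda>b. t m b - t n b"] by (simp add: t scaleR_left_diff_distrib sum_subtractf)
    finally show ?thesis .
  qed
  have cauchy: "Cauchy (\<lambda>n. t n b)" if b: "b \<in> B" for b
  proof (rule metric_CauchyI)
    fix e :: real assume "e > 0"
    have "Cauchy x"
      using l by (simp add: LIMSEQ_imp_Cauchy)
    then obtain M where M: "\<forall>m\<ge>M. \<forall>n\<ge>M. dist (x m) (x n) < e / (\<bar>c\<bar> + 1)"
      using \<open>e > 0\<close> by (meson metric_CauchyD abs_ge_zero divide_pos_pos le_add_same_cancel2
            less_add_one order_le_less_trans)
    have "dist (t m b) (t n b) < e" if "m \<ge> M" "n \<ge> M" for m n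
    proof -
      have "\<bar>t m b - t n b\<bar> \<le> (\<bar>c\<bar> + 1) * norm (x m - x n)"
        using diff[OF b, of m n]
        by (rule order_trans) (intro mult_right_mono, auto)
      also have "\<dots> < (\<bar>c\<bar> + 1) * (e / (\<bar>c\<bar> + 1))"
        using M that by (intro mult_strict_left_mono) (auto simp: dist_norm)
      finally show ?thesis by (simp add: dist_real_def)
    qed
    then show "\<exists>M. \<forall>m\<ge>M. \<forall>n\<ge>M. dist (t m b) (t n b) < e" by blast
  qed
  have "\<exists>s. (\<lambda>n. t n b) \<longlonglongrightarrow> s" if "b \<in> B" for b
    using cauchy[OF that] by (simp add: Cauchy_convergent_iff convergent_def)
  then obtain s where s: "\<And>b. b \<in> B \<Longrightarrow> (\<lambda>n. t n b) \<longlonglongrightarrow> s b"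
    by metis
  have "x \<longlonglongrightarrow> (\<Sum>b\<in>B. s b *\<^sub>R b)"
    unfolding t using s by (intro tendsto_sum tendsto_scaleR) auto
  then have "l = (\<Sum>b\<in>B. s b *\<^sub>R b)"
    using l LIMSEQ_unique by blast
  then show "l \<in> span B"
    by (auto simp: span_finite[OF fin])
qed

text \<open>
  This is the equivalence of norms in finite dimension. A new basis vector lies outside the span of
  the previous ones, which is closed by the induction hypothesis; so it has a positive distance from
  that span, and this distance bounds the new coordinate.
\<close>

lemma coordinates_bounded:
  fixes B :: "'a::real_normed_vector set"
  assumes "finite B" "independent B"
  shows "\<exists>c\<ge>0. \<forall>t. (\<Sum>b\<in>B. \<bar>t b\<bar>) \<le> c * norm (\<Sum>b\<in>B. t b *\<^sub>R b)"
  using assms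
proof (induction B rule: finite_induct)
  case empty
  show ?case by auto
next
  case (insert b B)
  from insert.prems insert.hyps have b: "b \<notin> span B" and ind: "independent B"
    by (auto simp: independent_insert)
  obtain c where c: "c \<ge> 0" "\<And>t. (\<Sum>b\<in>B. \<bar>t b\<bar>) \<le> c * norm (\<Sum>b\<in>B. t b *\<^sub>R b)"
    using insert.IH[OF ind] by blast
  have "closed (span B)"
    by (rule closed_span_if_coordinates_bounded[OF insert.hyps(1) c(2)])
  then have "open (- span B)" by auto
  then obtain d where d: "d > 0" "ball b d \<subseteq> - span B"
    using b by (meson ComplI openE)
  have dist: "d \<le> norm (b - w)" if "w \<in> span B" for w
    using d(2) that by (force simp: subset_iff dist_norm)
  have low: "\<bar>s\<bar> * d \<le> norm (s *\<^sub>R b + w)" if w: "w \<in> span B" for s w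
  proof (cases "s = 0")
    case False
    have "d \<le> norm (b - (- inverse s) *\<^sub>R w)"
      by (rule dist) (use w span_scale in blast)
    then have "\<bar>s\<bar> * d \<le> \<bar>s\<bar> * norm (b + inverse s *\<^sub>R w)"
      by (intro mult_left_mono) auto
    also have "\<dots> = norm (s *\<^sub>R (b + inverse s *\<^sub>R w))"
      by simp
    also have "s *\<^sub>R (b + inverse s *\<^sub>R w) = s *\<^sub>R b + w"
      using False by (simp add: scaleR_add_right)
    finally show ?thesis .
  qed auto
  define C where "C = (1 + c * norm b) / d + c"
  show ?case
  proof (intro exI[of _ C] conjI allI)
    show "C \<ge> 0" using c d by (simp add: C_def)
    fix t
    define w where "w = (\<Sum>b\<in>B. t b *\<^sub>R b)"
    have w: "w \<in> span B"
      by (auto simp: w_def intro: span_sum span_scale span_base)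
    let ?N = "norm (t b *\<^sub>R b + w)"
    have tb: "\<bar>t b\<bar> \<le> ?N / d"
      using low[OF w, of "t b"] d by (simp add: field_simps)
    have "norm w \<le> ?N + norm (t b *\<^sub>R b)"
      by (metis add_diff_cancel_left' norm_triangle_ineq4)
    then have nw: "norm w \<le> ?N + \<bar>t b\<bar> * norm b" by simp
    have "(\<Sum>b\<in>insert b B. \<bar>t b\<bar>) = \<bar>t b\<bar> + (\<Sum>b\<in>B. \<bar>t b\<bar>)"
      using insert.hyps by simp
    also have "\<dots> \<le> \<bar>t b\<bar> + c * (?N + \<bar>t b\<bar> * norm b)"
      using c(2)[of t] mult_left_mono[OF nw c(1)] by (simp add: w_def)
    also have "\<dots> = (1 + c * norm b) * \<bar>t b\<bar> + c * ?N"
      by (simp add: algebra_simps)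
    also have "\<dots> \<le> (1 + c * norm b) * (?N / d) + c * ?N"
      using tb c(1) by (intro add_right_mono mult_left_mono) auto
    also have "\<dots> = C * ?N"
      by (simp add: C_def algebra_simps)
    also have "t b *\<^sub>R b + w = (\<Sum>b\<in>insert b B. t b *\<^sub>R b)"
      using insert.hyps by (simp add: w_def)
    finally show "(\<Sum>b\<in>insert b B. \<bar>t b\<bar>) \<le> C * norm (\<Sum>b\<in>insert b B. t b *\<^sub>R b)" .
  qed
qed

context findim_space
begin

lemma sum_coordinates: "(\<Sum>b\<in>B. representation B x b *\<^sub>R b) = x"
  by (rule sum_representation_eq[OF independent_B])
     (use span_B finite_B in auto)

lemma linear_coordinate: "linear (\<lambda>x. representation B x b)"
  by (rule linearI)
     (use span_B independent_B in \<open>auto simp: representation_add representation_scale\<close>)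

lemma linear_imp_bounded_linear:
  fixes f :: "'a \<Rightarrow> 'b::real_normed_vector"
  assumes "linear f"
  shows "bounded_linear f"
proof -
  obtain c where c: "c \<ge> 0"
      "\<And>t. (\<Sum>b\<in>B. \<bar>t b\<bar>) \<le> c * norm (\<Sum>b\<in>B. t b *\<^sub>R b)"
    using coordinates_bounded[OF finite_B independent_B] by blast
  define M where "M = (\<Sum>b\<in>B. norm (f b))"
  have "norm (f x) \<le> norm x * (c * M)" for x
  proof -
    let ?t = "representation B x"
    have "norm (f x) = norm (\<Sum>b\<in>B. ?t b *\<^sub>R f b)"
      by (subst sum_coordinates[of x, symmetric])
         (simp add: linear_sum[OF assms] linear_scale[OF assms])
    also have "\<dots> \<le> (\<Sum>b\<in>B. \<bar>?t b\<bar> * norm (f b))"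
      by (rule sum_norm_le) simp
    also have "\<dots> \<le> (\<Sum>b\<in>B. \<bar>?t b\<bar> * M)"
      unfolding M_def
      by (intro sum_mono mult_left_mono member_le_sum) (use finite_B in auto)
    also have "\<dots> = (\<Sum>b\<in>B. \<bar>?t b\<bar>) * M"
      by (simp add: sum_distrib_right)
    also have "\<dots> \<le> (c * norm x) * M"
      using c(2)[of ?t] by (intro mult_right_mono) (auto simp: sum_coordinates M_def intro: sum_nonneg)
    finally show ?thesis by (simp add: mult_ac)
  qed
  then show ?thesis
    using assms by (auto intro!: bounded_linear_intro simp: linear_add linear_scale)
qed

lemma linear_imp_continuous_on:
  fixes f :: "'a \<Rightarrow> 'b::real_normed_vector"
  shows "linear f \<Longrightarrow> continuous_on S f"
  using linear_imp_bounded_linear bounded_linear.continuous_on[OF _ continuous_on_id]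
  by auto

text \<open>
  The matrix units of the basis span the endomorphisms.
\<close>

lemma findim_endomorphisms: "\<exists>E::('a \<Rightarrow>\<^sub>L 'a) set. finite E \<and> span E = UNIV"
proof -
  define E where "E b c = Blinfun (\<lambda>x. representation B x b *\<^sub>R c)" for b c :: 'a
  have lin: "linear (\<lambda>x. representation B x b *\<^sub>R c)" for b c :: 'a
    using linear_add[OF linear_coordinate[of b]] linear_scale[OF linear_coordinate[of b]]
    by (intro linearI) (auto simp: scaleR_left_distrib)
  have E: "blinfun_apply (E b c) x = representation B x b *\<^sub>R c" for b c x
    unfolding E_def by (simp add: bounded_linear_Blinfun_apply linear_imp_bounded_linear lin)
  have "g \<in> span (case_prod E ` (B \<times> B))" for g
  proof -
    have "g = (\<Sum>b\<in>B. \<Sum>c\<in>B. representation B (g b) c *\<^sub>R E b c)"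
    proof (rule blinfun_eqI)
      fix x
      let ?t = "representation B x"
      have "g x = (\<Sum>b\<in>B. ?t b *\<^sub>R g b)"
        by (subst sum_coordinates[of x, symmetric]) (simp add: blinfun.sum_right blinfun.scaleR_right)
      also have "\<dots> = (\<Sum>b\<in>B. \<Sum>c\<in>B. ?t b *\<^sub>R representation B (g b) c *\<^sub>R c)"
        by (subst (1) sum_coordinates[of "blinfun_apply g _", symmetric])
           (simp only: scaleR_sum_right)
      finally show "g x = (\<Sum>b\<in>B. \<Sum>c\<in>B. representation B (g b) c *\<^sub>R E b c) x"
        by (simp add: blinfun.sum_left blinfun.scaleR_left E mult_ac)
    qed
    also have "\<dots> \<in> span (case_prod E ` (B \<times> B))"
      by (intro span_sum span_scale span_base) auto
    finally show ?thesis .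
  qed
  then show ?thesis
    using finite_B by (intro exI[of _ "case_prod E ` (B \<times> B)"]) auto
qed

text \<open>
  The power series of a linear map has only a constant term and the terms of degree one, at the
  multi-indices called \<open>zer\<close> and \<open>one b\<close> below.
\<close>

lemma linear_real_analytic_at:
  fixes f :: "'a \<Rightarrow> 'b::real_normed_vector"
  assumes f: "linear f"
  shows "real_analytic_at f x"
proof -
  \<comment> \<open>Multi-indices are extensional functions, hence the restriction to \<open>B\<close>.\<close>
  define zer :: "'a \<Rightarrow> nat" where "zer = (\<lambda>_\<in>B. 0)"
  define one :: "'a \<Rightarrow> 'a \<Rightarrow> nat" where "one b = (\<lambda>k\<in>B. if k = b then 1 else 0)" for b
  define c where "c \<alpha> = (if \<alpha> = zer then f x else if \<alpha> \<in> one ` B then f (the_inv_into B one \<alpha>) else 0)"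
    for \<alpha>
  have inj: "inj_on one B"
  proof (rule inj_onI)
    fix a b assume "a \<in> B" "b \<in> B" "one a = one b"
    then have "one a a = one b a" by simp
    then show "a = b" using \<open>a \<in> B\<close> by (auto simp: one_def split: if_splits)
  qed
  have nz: "one b \<noteq> zer" if "b \<in> B" for b
  proof
    assume "one b = zer"
    then have "one b b = zer b" by simp
    then show False using that by (simp add: one_def zer_def)
  qed
  have c_one: "c (one b) = f b" if "b \<in> B" for b
    using that nz[OF that] by (simp add: c_def the_inv_into_f_f[OF inj])
  have "((\<lambda>\<alpha>. (\<Prod>b\<in>B. t b ^ \<alpha> b) *\<^sub>R c \<alpha>) has_sum f (x + (\<Sum>b\<in>B. t b *\<^sub>R b)))
          (B \<rightarrow>\<^sub>E (UNIV :: nat set))" for t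
  proof -
    let ?g = "\<lambda>\<alpha>. (\<Prod>b\<in>B. t b ^ \<alpha> b) *\<^sub>R c \<alpha>"
    have mon: "(\<Prod>k\<in>B. t k ^ one b k) = t b" if "b \<in> B" for b
    proof -
      have "(\<Prod>k\<in>B. t k ^ one b k) = (\<Prod>k\<in>B. if k = b then t k else 1)"
        by (rule prod.cong) (auto simp: one_def)
      also have "\<dots> = t b" using that finite_B by simp
      finally show ?thesis .
    qed
    have "(?g has_sum sum ?g (insert zer (one ` B))) (insert zer (one ` B))"
      by (rule has_sum_finite) (use finite_B in auto)
    also have "sum ?g (insert zer (one ` B)) = ?g zer + sum ?g (one ` B)"
      by (rule sum.insert) (use finite_B nz in auto)
    also have "sum ?g (one ` B) = (\<Sum>b\<in>B. t b *\<^sub>R f b)"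
      by (subst sum.reindex[OF inj]) (auto simp: mon c_one)
    also have "?g zer = f x"
      by (simp add: zer_def c_def cong: prod.cong)
    also have "f x + (\<Sum>b\<in>B. t b *\<^sub>R f b) = f (x + (\<Sum>b\<in>B. t b *\<^sub>R b))"
      by (simp add: linear_add[OF f] linear_sum[OF f] linear_scale[OF f])
    finally show ?thesis
    proof (rule has_sum_cong_neutral[THEN iffD1, rotated -1])
      show "?g \<alpha> = 0" if "\<alpha> \<in> (B \<rightarrow>\<^sub>E UNIV) - insert zer (one ` B)" for \<alpha>
        using that by (simp add: c_def)
      show "?g \<alpha> = 0" if "\<alpha> \<in> insert zer (one ` B) - (B \<rightarrow>\<^sub>E UNIV)" for \<alpha>
        using that by (auto simp: zer_def one_def)
    qed auto
  qed
  then show ?thesis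
    unfolding real_analytic_at_def
    by (intro exI[of _ B] exI[of _ c] exI[of _ 1] conjI finite_B independent_B span_B) auto
qed

end

text \<open>
  Around an inner point \<open>y\<close>, a small multiple of any vector is a difference \<open>(y + s x) - y\<close> of two elements
  of the set.
\<close>

lemma span_eq_UNIV_if_interior:
  fixes S :: "'a::real_normed_vector set"
  assumes "interior S \<noteq> {}"
  shows "span S = UNIV"
proof -
  obtain y d where d: "d > 0" "ball y d \<subseteq> S"
    using assms by (metis all_not_in_conv mem_interior)
  have y: "y \<in> span S" using d by (metis centre_in_ball span_base subsetD)
  have "x \<in> span S" for x
  proof (cases "x = 0")
    case False
    define s where "s = d / (2 * norm x)"
    have s: "s > 0" using d False by (simp add: s_def)
    have "y + s *\<^sub>R x \<in> ball y d"
      using d False by (simp add: s_def dist_norm)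
    then have "y + s *\<^sub>R x \<in> span S" using d by (auto intro: span_base)
    then have "(y + s *\<^sub>R x) - y \<in> span S" using y span_diff by blast
    then have "inverse s *\<^sub>R (s *\<^sub>R x) \<in> span S" by (simp only: add_diff_cancel_left' span_scale)
    then show ?thesis using s by simp
  qed (simp add: span_zero)
  then show ?thesis by auto
qed

section \<open>Ideals in a finite-dimensional commutative real algebra\<close>

text \<open>
  The multiplication is a parameter and not a type class operation, since it will be constructed
  from a group inside a proof.
\<close>

locale findim_comm_algebra = findim_space B for B :: "'a::real_normed_vector set" +
  fixes mul :: "'a \<Rightarrow> 'a \<Rightarrow> 'a" (infixl "\<star>" 70) and e :: 'a
  assumes distrib_left: "(x + y) \<star> z = x \<star> z + y \<star> z"
    and scale_left: "(c *\<^sub>R x) \<star> y = c *\<^sub>R (x \<star> y)"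
    and assoc: "(x \<star> y) \<star> z = x \<star> (y \<star> z)"
    and comm: "x \<star> y = y \<star> x"
    and unit_left [simp]: "e \<star> x = x"
begin

lemma unit_right [simp]: "x \<star> e = x"
  by (metis comm unit_left)

lemma distrib_right: "z \<star> (x + y) = z \<star> x + z \<star> y"
  by (simp add: comm[of z] distrib_left)

lemma scale_right: "x \<star> (c *\<^sub>R y) = c *\<^sub>R (x \<star> y)"
  by (simp add: comm[of x] scale_left)

lemma linear_mul_right: "linear (\<lambda>x. x \<star> y)"
  by (intro linearI) (auto simp: distrib_left scale_left)

lemma linear_mul_left: "linear (\<lambda>y. x \<star> y)"
  by (intro linearI) (auto simp: distrib_right scale_right)

lemma zero_left [simp]: "0 \<star> x = 0"
  using linear_0[OF linear_mul_right] .

lemma zero_right [simp]: "x \<star> 0 = 0"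
  using linear_0[OF linear_mul_left] .

lemma diff_left: "(x - y) \<star> z = x \<star> z - y \<star> z"
  using linear_diff[OF linear_mul_right] .

lemma diff_right: "z \<star> (x - y) = z \<star> x - z \<star> y"
  using linear_diff[OF linear_mul_left] .

lemma left_comm: "x \<star> (y \<star> z) = y \<star> (x \<star> z)"
  by (metis assoc comm)

lemmas ring_laws = distrib_left distrib_right diff_left diff_right scale_left scale_right
  assoc comm left_comm

definition is_ideal :: "'a set \<Rightarrow> bool" where
  "is_ideal I \<longleftrightarrow> subspace I \<and> (\<forall>x. \<forall>y\<in>I. x \<star> y \<in> I)"

definition maximal_ideal :: "'a set \<Rightarrow> bool" where
  "maximal_ideal M \<longleftrightarrow> is_ideal M \<and> M \<noteq> UNIV \<and>
     (\<forall>I. is_ideal I \<and> I \<noteq> UNIV \<and> M \<subseteq> I \<longrightarrow> I = M)"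

definition units :: "'a set" where
  "units = {x. \<exists>y. x \<star> y = e}"

lemma maximal_is_ideal: "maximal_ideal M \<Longrightarrow> is_ideal M"
  by (simp add: maximal_ideal_def)

lemma is_ideal_subspace: "is_ideal I \<Longrightarrow> subspace I"
  by (simp add: is_ideal_def)

lemma is_ideal_mul: "is_ideal I \<Longrightarrow> y \<in> I \<Longrightarrow> x \<star> y \<in> I"
  by (simp add: is_ideal_def)

lemma is_ideal_mul': "is_ideal I \<Longrightarrow> y \<in> I \<Longrightarrow> y \<star> x \<in> I"
  by (metis comm is_ideal_mul)

lemma unit_notin_ideal: "is_ideal I \<Longrightarrow> I \<noteq> UNIV \<Longrightarrow> e \<notin> I"
  using is_ideal_mul[of I e] by auto

lemma unit_notin_maximal: "maximal_ideal M \<Longrightarrow> e \<notin> M"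
  by (simp add: maximal_ideal_def unit_notin_ideal)

text \<open>
  An ideal of largest dimension among the proper ideals above \<open>I\<close> is maximal.
\<close>

lemma proper_ideal_in_maximal:
  assumes I: "is_ideal I" "I \<noteq> UNIV"
  obtains M where "maximal_ideal M" "I \<subseteq> M"
proof -
  let ?P = "\<lambda>W. is_ideal W \<and> W \<noteq> UNIV \<and> I \<subseteq> W"
  have "\<exists>W. ?P W \<and> (\<forall>W'. ?P W' \<longrightarrow> dim W' \<le> dim W)"
    by (rule ex_has_greatest_nat[of ?P I dim "Suc (dim (UNIV :: 'a set))"])
       (use I fd.dim_subset[OF subset_UNIV] in \<open>auto simp only: less_Suc_eq_le\<close>)
  then obtain M where M: "?P M" "\<And>W'. ?P W' \<Longrightarrow> dim W' \<le> dim M"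
    by blast
  have "maximal_ideal M"
    unfolding maximal_ideal_def
  proof (intro conjI allI impI)
    fix W assume W: "is_ideal W \<and> W \<noteq> UNIV \<and> M \<subseteq> W"
    then have "dim W \<le> dim M" using M by blast
    then show "W = M"
      using fd.subspace_dim_equal[of M W] W M(1) is_ideal_subspace by blast
  qed (use M in auto)
  then show thesis using that M(1) by blast
qed

lemma principal_is_ideal: "is_ideal (range (\<lambda>z. x \<star> z))"
  unfolding is_ideal_def
proof (intro conjI allI ballI)
  show "subspace (range (\<lambda>z. x \<star> z))"
    using linear_subspace_image[OF linear_mul_left subspace_UNIV] .
next
  fix y w assume "w \<in> range (\<lambda>z. x \<star> z)"
  then obtain z where "w = x \<star> z" by blast
  then have "y \<star> w = x \<star> (y \<star> z)" by (simp add: left_comm[of y x])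
  then show "y \<star> w \<in> range (\<lambda>z. x \<star> z)" by simp
qed

lemma sum_is_ideal:
  assumes "is_ideal I" "is_ideal K"
  shows "is_ideal {x + y |x y. x \<in> I \<and> y \<in> K}"
  unfolding is_ideal_def
proof (intro conjI allI ballI)
  show "subspace {x + y |x y. x \<in> I \<and> y \<in> K}"
    using assms subspace_sums is_ideal_subspace by blast
next
  fix z w assume "w \<in> {x + y |x y. x \<in> I \<and> y \<in> K}"
  then obtain x y where "w = x + y" "x \<in> I" "y \<in> K" by blast
  then show "z \<star> w \<in> {x + y |x y. x \<in> I \<and> y \<in> K}"
    using assms is_ideal_mul distrib_right by blast
qed

lemma maximal_sum_UNIV:
  assumes M: "maximal_ideal M" and I: "is_ideal I" "\<not> I \<subseteq> M"
  shows "{x + y |x y. x \<in> M \<and> y \<in> I} = UNIV"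
proof (rule ccontr)
  define S where "S = {x + y |x y. x \<in> M \<and> y \<in> I}"
  assume "{x + y |x y. x \<in> M \<and> y \<in> I} \<noteq> UNIV"
  then have proper: "S \<noteq> UNIV" by (simp add: S_def)
  have 0: "0 \<in> M" "0 \<in> I"
    using M I by (auto simp: maximal_ideal_def is_ideal_def subspace_0)
  have "x + y \<in> S" if "x \<in> M" "y \<in> I" for x y
    using that by (auto simp: S_def)
  from this[OF _ 0(2)] this[OF 0(1)] have sub: "M \<subseteq> S" "I \<subseteq> S"
    by auto
  have "is_ideal S"
    unfolding S_def using sum_is_ideal M I(1) maximal_is_ideal by blast
  then have "S = M"
    using M sub(1) proper by (simp add: maximal_ideal_def)
  then show False
    using sub(2) I(2) by simp
qed

text \<open>
  The quotient by a maximal ideal is a field; this and the next lemma express it by congruences.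
\<close>

lemma inverse_modulo_maximal:
  assumes M: "maximal_ideal M" and x: "x \<notin> M"
  obtains y where "x \<star> y - e \<in> M"
proof -
  have "\<not> range (\<lambda>z. x \<star> z) \<subseteq> M"
    using x by (metis rangeI subsetD unit_right)
  then have "e \<in> {m + z |m z. m \<in> M \<and> z \<in> range (\<lambda>z. x \<star> z)}"
    using maximal_sum_UNIV[OF M principal_is_ideal] by blast
  then obtain m y where "e = m + x \<star> y" "m \<in> M" by blast
  then have "x \<star> y - e = - m" by (simp add: algebra_simps)
  then show thesis
    using that \<open>m \<in> M\<close> M by (metis maximal_is_ideal is_ideal_subspace subspace_neg)
qed

lemma maximal_is_prime:
  assumes M: "maximal_ideal M" and xy: "x \<star> y \<in> M"
  shows "x \<in> M \<or> y \<in> M"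
proof (rule ccontr)
  assume "\<not> (x \<in> M \<or> y \<in> M)"
  then obtain z where z: "x \<star> z - e \<in> M" and y: "y \<notin> M"
    using inverse_modulo_maximal[OF M] by blast
  note I = maximal_is_ideal[OF M]
  have "z \<star> (x \<star> y) - y \<star> (x \<star> z - e) \<in> M"
    using I is_ideal_mul xy z is_ideal_subspace subspace_diff by blast
  also have "z \<star> (x \<star> y) - y \<star> (x \<star> z - e) = y"
    by (simp add: ring_laws)
  finally show False using y by blast
qed

text \<open>
  This is Horner's scheme.
\<close>

definition peval :: "real poly \<Rightarrow> 'a \<Rightarrow> 'a" where
  "peval p a = fold_coeffs (\<lambda>c y. c *\<^sub>R e + a \<star> y) p 0"

lemma peval_0 [simp]: "peval 0 a = 0"
  by (simp add: peval_def)

lemma peval_pCons [simp]: "peval (pCons c p) a = c *\<^sub>R e + a \<star> peval p a"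
  by (cases "p = 0 \<and> c = 0") (auto simp: peval_def)

lemma peval_add: "peval (p + q) a = peval p a + peval q a"
  by (induction p q rule: poly_induct2) (auto simp: ring_laws scaleR_left_distrib)

lemma peval_smult: "peval (smult c p) a = c *\<^sub>R peval p a"
  by (induction p) (auto simp: ring_laws scaleR_right_distrib)

lemma peval_diff: "peval (p - q) a = peval p a - peval q a"
  using peval_add[of p "smult (-1) q" a] peval_smult[of "-1" q a] by simp

lemma peval_sum: "peval (sum p I) a = (\<Sum>i\<in>I. peval (p i) a)"
  by (induction I rule: infinite_finite_induct) (auto simp: peval_add)

lemma peval_mult: "peval (p * q) a = peval p a \<star> peval q a"
  by (induction p) (auto simp: ring_laws peval_add peval_smult mult_pCons_left)

text \<open>
  There are more powers of \<open>a\<close> than the dimension allows to be independent. Two powers may coincide, in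
  which case their difference does the job.
\<close>

lemma annihilating_polynomial:
  shows "\<exists>p. p \<noteq> 0 \<and> peval p a = 0"
proof -
  define n where "n = dim (UNIV :: 'a set)"
  define pw where "pw i = peval (Polynomial.monom 1 i) a" for i
  have mon: "peval (Polynomial.monom c i) a = c *\<^sub>R pw i" for c i
    using peval_smult[of c "Polynomial.monom 1 i" a] by (simp add: pw_def smult_monom)
  show ?thesis
  \<comment> \<open>Dependence of the set of powers yields coefficients indexed by vectors; they only become
    coefficients of a polynomial if the powers are distinct.\<close>
  proof (cases "inj_on pw {..n}")
    case False
    then obtain i j where "i \<noteq> j" "pw i = pw j" by (auto simp: inj_on_def)
    moreover have "Polynomial.monom (1::real) i - Polynomial.monom 1 j \<noteq> 0"
      using \<open>i \<noteq> j\<close> by (metis coeff_monom eq_iff_diff_eq_0 zero_neq_one)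
    ultimately show ?thesis
      by (intro exI[of _ "Polynomial.monom 1 i - Polynomial.monom 1 j"])
         (auto simp: peval_diff mon)
  next
    case True
    let ?S = "pw ` {..n}"
    have "card ?S = Suc n" using True by (simp add: card_image)
    then have "dependent ?S"
      using fd.independent_card_le_dim[of ?S UNIV] by (auto simp: n_def)
    then obtain u where u: "\<exists>v\<in>?S. u v \<noteq> 0" "(\<Sum>v\<in>?S. u v *\<^sub>R v) = 0"
      by (auto simp: dependent_finite)
    define p where "p = (\<Sum>i\<le>n. Polynomial.monom (u (pw i)) i)"
    have "peval p a = (\<Sum>i\<le>n. u (pw i) *\<^sub>R pw i)"
      by (simp add: p_def peval_sum mon)
    also have "\<dots> = 0"
      using u(2) by (simp add: sum.reindex[OF True])
    finally have "peval p a = 0" .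
    moreover obtain k where k: "k \<le> n" "u (pw k) \<noteq> 0" using u(1) by auto
    have "Polynomial.coeff p k = u (pw k)"
      using k(1) by (simp add: p_def coeff_sum)
    then have "p \<noteq> 0" using k(2) by auto
    ultimately show ?thesis by blast
  qed
qed

end

lemma poly_map_of_real:
  "poly (map_poly complex_of_real p) (complex_of_real x) = complex_of_real (poly p x)"
  by (induction p) (auto simp: map_poly_pCons)

lemma poly_map_of_real_add:
  "poly (map_poly complex_of_real (p + q)) z
    = poly (map_poly complex_of_real p) z + poly (map_poly complex_of_real q) z"
  by (induction p q rule: poly_induct2) (auto simp: map_poly_pCons algebra_simps)

lemma poly_map_of_real_smult:
  "poly (map_poly complex_of_real (smult c q)) z = complex_of_real c * poly (map_poly complex_of_real q) z"
  by (induction q) (auto simp: map_poly_pCons algebra_simps)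

lemma poly_map_of_real_mult:
  "poly (map_poly complex_of_real (p * q)) z
    = poly (map_poly complex_of_real p) z * poly (map_poly complex_of_real q) z"
  by (induction p)
     (auto simp: map_poly_pCons algebra_simps poly_map_of_real_add poly_map_of_real_smult)

text \<open>
  Take a complex root. If it is not real, then the remainder modulo its real quadratic polynomial is linear
  and vanishes at a nonreal point, hence is zero.
\<close>

lemma real_poly_linear_or_quadratic_factor:
  fixes p :: "real poly"
  assumes "Polynomial.degree p > 0"
  shows "(\<exists>c. [:-c, 1:] dvd p) \<or> (\<exists>s t. t \<noteq> 0 \<and> [:s\<^sup>2 + t\<^sup>2, -2 * s, 1:] dvd p)"
proof -
  let ?P = "map_poly complex_of_real p"
  have "\<not> constant (poly ?P)"
    using assms by (subst constant_degree) (simp add: degree_map_poly)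
  then obtain z where z: "poly ?P z = 0"
    using fundamental_theorem_of_algebra by blast
  show ?thesis
  proof (cases "Im z = 0")
    case True
    then have "z = complex_of_real (Re z)" by (simp add: complex_eq_iff)
    then have "complex_of_real (poly p (Re z)) = 0"
      using z by (metis poly_map_of_real)
    then have "poly p (Re z) = 0" by simp
    then show ?thesis by (auto simp: poly_eq_0_iff_dvd)
  next
    case False
    define q where "q = [:(Re z)\<^sup>2 + (Im z)\<^sup>2, -2 * Re z, 1:]"
    have q: "poly (map_poly complex_of_real q) z = 0"
      by (simp add: q_def map_poly_pCons complex_eq_iff power2_eq_square algebra_simps)
    define m where "m = p mod q"
    have "Polynomial.degree m < 2"
      using degree_mod_less[of q p] by (auto simp: m_def q_def)
    then obtain u v where uv: "m = [:u, v:]"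
      by (metis degree_eq_zeroE degree_pCons_eq_if less_2_cases_iff nat.inject pCons_cases
          One_nat_def pCons_0_0)
    have "poly ?P z = poly (map_poly complex_of_real (p div q * q + m)) z"
      by (simp add: m_def)
    then have "poly (map_poly complex_of_real m) z = 0"
      using z q by (simp only: poly_map_of_real_add poly_map_of_real_mult) simp
    then have "u = 0 \<and> v = 0"
      using False by (auto simp: uv map_poly_pCons complex_eq_iff)
    then have "q dvd p" using uv by (simp add: m_def dvd_eq_mod_eq_0)
    then show ?thesis using False by (auto simp: q_def)
  qed
qed

section \<open>Residue fields and characters\<close>

context findim_comm_algebra
begin

text \<open>
  A nonzero polynomial of least degree with value at \<open>a\<close> in \<open>M\<close> has a linear or quadratic factor. The value of
  the cofactor is not in \<open>M\<close> by minimality, so the value of the factor is in the prime ideal \<open>M\<close>.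
\<close>

lemma quadratic_modulo_maximal:
  assumes M: "maximal_ideal M"
  shows "(\<exists>c. a - c *\<^sub>R e \<in> M) \<or>
    (\<exists>s t. t \<noteq> 0 \<and> (a - s *\<^sub>R e) \<star> (a - s *\<^sub>R e) + t\<^sup>2 *\<^sub>R e \<in> M)"
proof -
  let ?P = "\<lambda>p. p \<noteq> 0 \<and> peval p a \<in> M"
  have "\<exists>p. ?P p"
    using annihilating_polynomial[of a] M
    by (metis maximal_is_ideal is_ideal_subspace subspace_0)
  then obtain p where p: "?P p" "\<And>q. ?P q \<Longrightarrow> Polynomial.degree p \<le> Polynomial.degree q"
    using ex_has_least_nat[of ?P _ Polynomial.degree] by blast
  have "Polynomial.degree p > 0"
  proof (rule ccontr)
    assume "\<not> Polynomial.degree p > 0"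
    then obtain c where c: "p = [:c:]" by (auto elim: degree_eq_zeroE)
    then have "c \<noteq> 0" "c *\<^sub>R e \<in> M" using p(1) by auto
    then have "e \<in> M"
      using M subspace_scale[of M "c *\<^sub>R e" "inverse c"]
      by (simp add: maximal_is_ideal is_ideal_subspace)
    then show False using unit_notin_maximal[OF M] by blast
  qed
  have factor: "peval q a \<in> M" if q: "q dvd p" "Polynomial.degree q > 0" for q
  proof -
    obtain k where k: "p = q * k" using q(1) by blast
    then have nz: "q \<noteq> 0" "k \<noteq> 0" using p(1) by auto
    then have "Polynomial.degree k < Polynomial.degree p"
      using q(2) by (simp add: k degree_mult_eq)
    then have "peval k a \<notin> M" using p(2) nz by (meson not_le)
    moreover have "peval q a \<star> peval k a \<in> M" using p(1) by (simp add: k peval_mult)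
    ultimately show ?thesis using maximal_is_prime[OF M] by blast
  qed
  from real_poly_linear_or_quadratic_factor[OF \<open>Polynomial.degree p > 0\<close>] show ?thesis
  proof (elim disjE exE conjE)
    fix c assume "[:-c, 1:] dvd p"
    then have "peval [:-c, 1:] a \<in> M" by (intro factor) auto
    then have "a - c *\<^sub>R e \<in> M" by (simp add: algebra_simps)
    then show ?thesis by blast
  next
    fix s t :: real assume t: "t \<noteq> 0" and "[:s\<^sup>2 + t\<^sup>2, -2 * s, 1:] dvd p"
    then have "peval [:s\<^sup>2 + t\<^sup>2, -2 * s, 1:] a \<in> M" by (intro factor) auto
    also have "peval [:s\<^sup>2 + t\<^sup>2, -2 * s, 1:] a
        = (a - s *\<^sub>R e) \<star> (a - s *\<^sub>R e) + t\<^sup>2 *\<^sub>R e"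
      by (simp add: ring_laws algebra_simps power2_eq_square flip: scaleR_2)
    finally show ?thesis using t by blast
  qed
qed

lemma difference_of_squares: "(x - y) \<star> (x + y) = x \<star> x - y \<star> y"
  by (simp add: distrib_right diff_left comm[of y x])

text \<open>
  Unless all residues are real, some element satisfies a quadratic equation that normalizes to
  \<open>J\<^sup>2 = -1\<close> modulo \<open>M\<close>. If then \<open>b\<close> satisfies \<open>(b - s)\<^sup>2 = -t\<^sup>2\<close>, the difference of squares
  \<open>(b - s)\<^sup>2 - (t J)\<^sup>2\<close> is in \<open>M\<close> and factors, so \<open>b\<close> is \<open>s + t J\<close> or \<open>s - t J\<close> modulo \<open>M\<close>.
\<close>

lemma residues_modulo_maximal:
  assumes M: "maximal_ideal M"
  shows "(\<forall>a. \<exists>s. a - s *\<^sub>R e \<in> M) \<or>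
    (\<exists>J. J \<star> J + e \<in> M \<and> (\<forall>a. \<exists>s t. a - (s *\<^sub>R e + t *\<^sub>R J) \<in> M))"
proof (rule disj_imp[THEN iffD2], rule impI)
  note sub = is_ideal_subspace[OF maximal_is_ideal[OF M]]
  assume "\<not> (\<forall>a. \<exists>s. a - s *\<^sub>R e \<in> M)"
  then obtain a s t where t: "t \<noteq> 0"
    and a: "(a - s *\<^sub>R e) \<star> (a - s *\<^sub>R e) + t\<^sup>2 *\<^sub>R e \<in> M"
    using quadratic_modulo_maximal[OF M] by blast
  define J where "J = inverse t *\<^sub>R (a - s *\<^sub>R e)"
  have "(inverse t)\<^sup>2 * t\<^sup>2 = 1"
    using t by (simp add: power2_eq_square field_simps)
  then have "J \<star> J + e = (inverse t)\<^sup>2 *\<^sub>R ((a - s *\<^sub>R e) \<star> (a - s *\<^sub>R e) + t\<^sup>2 *\<^sub>R e)"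
    by (simp add: J_def scale_left scale_right scaleR_add_right power2_eq_square)
  then have J: "J \<star> J + e \<in> M" using subspace_scale[OF sub a] by simp
  have "\<exists>s t. b - (s *\<^sub>R e + t *\<^sub>R J) \<in> M" for b
    using quadratic_modulo_maximal[OF M, of b]
  proof (elim disjE exE conjE)
    fix c assume "b - c *\<^sub>R e \<in> M"
    then show ?thesis by (intro exI[of _ c] exI[of _ 0]) simp
  next
    fix s t :: real assume b: "(b - s *\<^sub>R e) \<star> (b - s *\<^sub>R e) + t\<^sup>2 *\<^sub>R e \<in> M"
    let ?c = "b - s *\<^sub>R e"
    have "(?c \<star> ?c + t\<^sup>2 *\<^sub>R e) - t\<^sup>2 *\<^sub>R (J \<star> J + e) \<in> M"
      using subspace_diff[OF sub b subspace_scale[OF sub J]] .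
    also have "(?c \<star> ?c + t\<^sup>2 *\<^sub>R e) - t\<^sup>2 *\<^sub>R (J \<star> J + e) = (?c - t *\<^sub>R J) \<star> (?c + t *\<^sub>R J)"
      using difference_of_squares[of ?c "t *\<^sub>R J"]
      by (simp add: scale_left scale_right scaleR_add_right power2_eq_square)
    finally have "?c - t *\<^sub>R J \<in> M \<or> ?c + t *\<^sub>R J \<in> M"
      using maximal_is_prime[OF M] by blast
    then show ?thesis
    proof
      assume "?c - t *\<^sub>R J \<in> M"
      then show ?thesis by (intro exI[of _ s] exI[of _ t]) (simp add: algebra_simps)
    next
      assume "?c + t *\<^sub>R J \<in> M"
      then show ?thesis by (intro exI[of _ s] exI[of _ "-t"]) (simp add: algebra_simps)
    qed
  qed
  then show "\<exists>J. J \<star> J + e \<in> M \<and> (\<forall>a. \<exists>s t. a - (s *\<^sub>R e + t *\<^sub>R J) \<in> M)"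
    using J by blast
qed

lemma codim_eq_card_complement_basis:
  fixes M X :: "'a set"
  assumes M: "subspace M" and X: "finite X" "independent X"
    and triv: "\<And>x. x \<in> span X \<Longrightarrow> x \<in> M \<Longrightarrow> x = 0"
    and compl: "\<And>a. \<exists>x\<in>span X. a - x \<in> M"
  shows "codim M = card X"
proof -
  have "{x + y |x y. x \<in> M \<and> y \<in> span X} = UNIV"
    using compl by (metis (mono_tags, lifting) UNIV_eq_I diff_add_cancel mem_Collect_eq)
  moreover have "M \<inter> span X = {0}"
    using triv M by (auto simp: subspace_0 span_zero)
  ultimately have "dim (UNIV :: 'a set) = dim M + dim (span X)"
    using fd.dim_sums_Int[OF M, of "span X"] by simp
  then show ?thesis
    using dim_span_eq_card_independent[OF X(2)] by (simp add: codim_def)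
qed

definition is_character :: "('a \<Rightarrow> complex) \<Rightarrow> bool" where
  "is_character \<phi> \<longleftrightarrow> linear \<phi> \<and> (\<forall>x y. \<phi> (x \<star> y) = \<phi> x * \<phi> y) \<and> \<phi> e = 1"

text \<open>
  The real and the complex case are treated together: \<open>K\<close> is the residue field inside the complex
  numbers and \<open>\<iota>\<close> lifts its elements to the algebra. Every element \<open>a\<close> is congruent to a unique lift, which
  defines the character, and the space of all lifts is a complement of \<open>M\<close>, which gives its codimension.
  On the reals \<open>\<iota>\<close> does not depend on \<open>J\<close>.
\<close>

lemma character_of_residues:
  fixes J :: 'a and K :: "complex set"
  defines "\<iota> \<equiv> \<lambda>z. Re z *\<^sub>R e + Im z *\<^sub>R J"
  assumes M: "maximal_ideal M"
    and K: "K = \<real> \<or> (K = UNIV \<and> J \<star> J + e \<in> M)"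
    and res: "\<And>a. \<exists>z\<in>K. a - \<iota> z \<in> M"
  shows "\<exists>\<phi>. is_character \<phi> \<and> {x. \<phi> x = 0} = M \<and> range \<phi> = K"
    and "codim M = (if K = \<real> then 1 else 2)"
proof -
  note I = maximal_is_ideal[OF M] and sub = is_ideal_subspace[OF maximal_is_ideal[OF M]]
  have K_closed: "z + w \<in> K" "z * w \<in> K" "c *\<^sub>R z \<in> K" "z - w \<in> K" "0 \<in> K" "1 \<in> K"
    if "z \<in> K" "w \<in> K" for z w c
    using K that by (auto simp: scaleR_conv_of_real)
  have \<iota>_add: "\<iota> (z + w) = \<iota> z + \<iota> w" and \<iota>_diff: "\<iota> (z - w) = \<iota> z - \<iota> w"
    and \<iota>_scale: "\<iota> (c *\<^sub>R z) = c *\<^sub>R \<iota> z" for z w c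
    by (simp_all add: \<iota>_def algebra_simps)
  have \<iota>_mult: "\<iota> z \<star> \<iota> w - \<iota> (z * w) \<in> M" if zw: "z \<in> K" "w \<in> K" for z w
  proof -
    have eq: "\<iota> z \<star> \<iota> w - \<iota> (z * w) = (Im z * Im w) *\<^sub>R (J \<star> J + e)"
      by (simp add: \<iota>_def distrib_left distrib_right scale_left scale_right algebra_simps)
    from K show ?thesis
    proof
      assume "K = \<real>"
      then show ?thesis using zw eq sub by (auto simp: complex_is_Real_iff subspace_0)
    next
      assume "K = UNIV \<and> J \<star> J + e \<in> M"
      then show ?thesis using eq sub by (auto simp: subspace_scale)
    qed
  qed
  \<comment> \<open>A nonzero \<open>z\<close> with a lift in \<open>M\<close> would put the lift \<open>e\<close> of \<open>z * inverse z\<close> into \<open>M\<close>.\<close>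
  have inj: "z = 0" if z: "z \<in> K" "\<iota> z \<in> M" for z
  proof (rule ccontr)
    assume nz: "z \<noteq> 0"
    have cnj: "inverse z \<in> K"
      using K z(1) by (auto simp: Reals_inverse)
    have "\<iota> z \<star> \<iota> (inverse z) - (\<iota> z \<star> \<iota> (inverse z) - \<iota> (z * inverse z)) \<in> M"
      using subspace_diff[OF sub is_ideal_mul'[OF I z(2)] \<iota>_mult[OF z(1) cnj]] .
    then show False using nz unit_notin_maximal[OF M] by (simp add: \<iota>_def)
  qed
  define \<phi> where "\<phi> a = (THE z. z \<in> K \<and> a - \<iota> z \<in> M)" for a
  have \<phi>_eq: "\<phi> a = z" if z: "z \<in> K" "a - \<iota> z \<in> M" for a z
    unfolding \<phi>_def
  proof (rule the_equality)
    fix w assume w: "w \<in> K \<and> a - \<iota> w \<in> M"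
    have "(a - \<iota> z) - (a - \<iota> w) \<in> M" using z(2) w subspace_diff[OF sub] by blast
    then have "\<iota> (w - z) \<in> M" by (simp add: \<iota>_diff)
    then have "w - z = 0" using w z(1) K_closed(4) inj by blast
    then show "w = z" by simp
  qed (use z in auto)
  have \<phi>: "\<phi> a \<in> K" "a - \<iota> (\<phi> a) \<in> M" for a
    using res[of a] \<phi>_eq by auto
  have "linear \<phi>"
  proof (rule linearI)
    fix a b :: 'a and c :: real
    have "(a - \<iota> (\<phi> a)) + (b - \<iota> (\<phi> b)) \<in> M" using \<phi> subspace_add[OF sub] by blast
    then show "\<phi> (a + b) = \<phi> a + \<phi> b"
      by (intro \<phi>_eq K_closed \<phi>) (simp add: \<iota>_add algebra_simps)
    have "c *\<^sub>R (a - \<iota> (\<phi> a)) \<in> M" using \<phi> subspace_scale[OF sub] by blast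
    then show "\<phi> (c *\<^sub>R a) = c *\<^sub>R \<phi> a"
      by (intro \<phi>_eq K_closed(3)[OF \<phi>(1) \<phi>(1)]) (simp add: \<iota>_scale scaleR_diff_right)
  qed
  moreover have "\<phi> (a \<star> b) = \<phi> a * \<phi> b" for a b
  proof (rule \<phi>_eq)
    let ?z = "\<phi> a" and ?w = "\<phi> b"
    have "(a - \<iota> ?z) \<star> b + \<iota> ?z \<star> (b - \<iota> ?w) + (\<iota> ?z \<star> \<iota> ?w - \<iota> (?z * ?w)) \<in> M"
      by (intro subspace_add[OF sub] is_ideal_mul[OF I] is_ideal_mul'[OF I] \<iota>_mult \<phi>)
    then show "a \<star> b - \<iota> (?z * ?w) \<in> M"
      by (simp add: diff_left diff_right)
  qed (use \<phi> K_closed in auto)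
  moreover have "\<phi> e = 1"
    by (rule \<phi>_eq) (use K_closed[OF \<phi>(1) \<phi>(1)] sub in \<open>auto simp: \<iota>_def subspace_0\<close>)
  ultimately have char: "is_character \<phi>" by (simp add: is_character_def)
  have ker: "{x. \<phi> x = 0} = M"
  proof (intro equalityI subsetI)
    fix x assume "x \<in> {x. \<phi> x = 0}"
    then show "x \<in> M" using \<phi>(2)[of x] by (simp add: \<iota>_def)
  next
    fix x assume "x \<in> M"
    then have "\<phi> x = 0"
      by (intro \<phi>_eq K_closed(5)[OF \<phi>(1) \<phi>(1)]) (simp add: \<iota>_def)
    then show "x \<in> {x. \<phi> x = 0}" by simp
  qed
  have "z \<in> range \<phi>" if "z \<in> K" for z
  proof -
    have "\<phi> (\<iota> z) = z" by (rule \<phi>_eq[OF that]) (use sub in \<open>simp add: subspace_0\<close>)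
    then show ?thesis by (metis rangeI)
  qed
  then have "range \<phi> = K" using \<phi>(1) by blast
  then show "\<exists>\<phi>. is_character \<phi> \<and> {x. \<phi> x = 0} = M \<and> range \<phi> = K"
    using char ker by blast
  have e: "e \<noteq> 0" using unit_notin_maximal[OF M] sub subspace_0 by blast
  show "codim M = (if K = \<real> then 1 else 2)"
  proof (cases "K = \<real>")
    case True
    have "codim M = card {e}"
    proof (rule codim_eq_card_complement_basis[OF sub])
      fix x assume "x \<in> span {e}" "x \<in> M"
      then obtain c where x: "x = c *\<^sub>R e" by (auto simp: span_singleton)
      then have "\<iota> (complex_of_real c) \<in> M" using \<open>x \<in> M\<close> by (simp add: \<iota>_def)
      then have "complex_of_real c = 0" by (intro inj) (auto simp: True)
      then show "x = 0" using x by simp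
    next
      fix a
      obtain z where "z \<in> \<real>" "a - \<iota> z \<in> M" using res[of a] True by blast
      then show "\<exists>x\<in>span {e}. a - x \<in> M"
        by (auto simp: \<iota>_def span_singleton complex_is_Real_iff)
    qed (use e in auto)
    then show ?thesis using True by simp
  next
    case False
    then have K': "K = UNIV" using K by blast
    have J: "J \<notin> span {e}"
    proof
      assume "J \<in> span {e}"
      then obtain c where "J = c *\<^sub>R e" by (auto simp: span_singleton)
      then have "\<iota> (Complex (-c) 1) = 0" by (simp add: \<iota>_def)
      then have "Complex (-c) 1 = 0" using inj K' sub by (simp add: subspace_0)
      then show False by (simp add: complex_eq_iff)
    qed
    have span: "x \<in> span {e, J} \<longleftrightarrow> (\<exists>z. x = \<iota> z)" for x
    proof
      assume "x \<in> span {e, J}"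
      then obtain s t where "x = s *\<^sub>R e + t *\<^sub>R J"
        by (auto simp: span_breakdown_eq[of x e] span_singleton algebra_simps)
      then have "x = \<iota> (Complex s t)" by (simp add: \<iota>_def)
      then show "\<exists>z. x = \<iota> z" by blast
    next
      assume "\<exists>z. x = \<iota> z"
      then show "x \<in> span {e, J}"
        by (auto simp: \<iota>_def intro!: span_add span_scale intro: span_base)
    qed
    have "codim M = card {J, e}"
    proof (rule codim_eq_card_complement_basis[OF sub])
      show "independent {J, e}"
        using J e by (simp add: independent_insert)
      show "x = 0" if x: "x \<in> span {J, e}" "x \<in> M" for x
      proof -
        obtain z where z: "x = \<iota> z" using x(1) span[of x] by (auto simp: insert_commute)
        then have "z = 0" using inj x(2) K' by blast
        then show ?thesis by (simp add: z \<iota>_def)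
      qed
      show "\<exists>x\<in>span {J, e}. a - x \<in> M" for a
        using res[of a] span by (auto simp: insert_commute[of J e])
    qed auto
    moreover have "J \<noteq> e" using J by (auto intro: span_base)
    ultimately show ?thesis using False by simp
  qed
qed

lemma character_exists:
  assumes M: "maximal_ideal M"
  shows "\<exists>\<phi>. is_character \<phi> \<and> {x. \<phi> x = 0} = M \<and>
    (codim M = 1 \<and> range \<phi> = \<real> \<or> codim M = 2 \<and> range \<phi> = UNIV)"
  using residues_modulo_maximal[OF M]
proof
  assume "\<forall>a. \<exists>s. a - s *\<^sub>R e \<in> M"
  then have "\<exists>z\<in>\<real>. a - (Re z *\<^sub>R e + Im z *\<^sub>R e) \<in> M" for a
    by (metis Im_complex_of_real Re_complex_of_real Reals_of_real add.right_neutral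
        real_vector.scale_zero_left)
  from character_of_residues[OF M _ this] show ?thesis by auto
next
  assume "\<exists>J. J \<star> J + e \<in> M \<and> (\<forall>a. \<exists>s t. a - (s *\<^sub>R e + t *\<^sub>R J) \<in> M)"
  then obtain J where J: "J \<star> J + e \<in> M" "\<And>a. \<exists>s t. a - (s *\<^sub>R e + t *\<^sub>R J) \<in> M"
    by blast
  have "\<exists>z\<in>UNIV. a - (Re z *\<^sub>R e + Im z *\<^sub>R J) \<in> M" for a
    using J(2)[of a] by (metis UNIV_I complex.sel)
  from character_of_residues[OF M _ this] J(1) show ?thesis
    using complex_is_Real_iff[of \<i>] by (metis UNIV_I imaginary_unit.sel(2) zero_neq_one)
qed

text \<open>
  For codimension two the character is unique only up to complex conjugation, hence the choice.
\<close>

definition chi :: "'a set \<Rightarrow> 'a \<Rightarrow> complex" where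
  "chi M = (SOME \<phi>. is_character \<phi> \<and> {x. \<phi> x = 0} = M \<and>
    (codim M = 1 \<and> range \<phi> = \<real> \<or> codim M = 2 \<and> range \<phi> = UNIV))"

context
  fixes M assumes M: "maximal_ideal M"
begin

lemma chi_props:
  "is_character (chi M)" "{x. chi M x = 0} = M"
  "codim M = 1 \<and> range (chi M) = \<real> \<or> codim M = 2 \<and> range (chi M) = UNIV"
  using someI_ex[OF character_exists[OF M]] unfolding chi_def by blast+

lemma chi_linear: "linear (chi M)" and chi_mul: "chi M (x \<star> y) = chi M x * chi M y"
  and chi_unit [simp]: "chi M e = 1"
  using chi_props(1) by (auto simp: is_character_def)

lemma chi_eq_0_iff: "chi M x = 0 \<longleftrightarrow> x \<in> M"
  using chi_props(2) by auto

lemma chi_range_codim1: "codim M = 1 \<Longrightarrow> range (chi M) = \<real>"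
  and chi_range_not_codim1: "codim M \<noteq> 1 \<Longrightarrow> range (chi M) = UNIV"
  and codim_maximal: "codim M = 1 \<or> codim M = 2"
  using chi_props(3) by auto

lemma chi_codim1: "codim M = 1 \<Longrightarrow> chi M x = complex_of_real (Re (chi M x))"
  using chi_range_codim1 by (metis of_real_Re rangeI)

lemma continuous_on_chi: "continuous_on S (chi M)"
  using linear_imp_continuous_on[OF chi_linear] .

end

lemma maximal_ideal_not_subset:
  "maximal_ideal K \<Longrightarrow> maximal_ideal M \<Longrightarrow> K \<noteq> M \<Longrightarrow> \<not> K \<subseteq> M"
  unfolding maximal_ideal_def by blast

text \<open>
  Multiply elements of the members of \<open>F\<close> that lie outside \<open>M\<close>, using that \<open>M\<close> is prime.
\<close>

lemma prime_avoidance: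
  assumes M: "maximal_ideal M" and "finite F" "F \<subseteq> Collect maximal_ideal" "M \<notin> F"
  shows "\<exists>x\<in>\<Inter>F. x \<notin> M"
  using assms(2-)
proof (induction F rule: finite_induct)
  case empty
  then show ?case using unit_notin_maximal[OF M] by auto
next
  case (insert K F)
  then obtain x where x: "x \<in> \<Inter>F" "x \<notin> M" by auto
  obtain k where k: "k \<in> K" "k \<notin> M"
    using insert.prems maximal_ideal_not_subset[OF _ M, of K] by auto
  have "k \<star> x \<in> L" if "L \<in> insert K F" for L
  proof (cases "L = K")
    case True
    then show ?thesis
      using k insert.prems by (auto intro!: is_ideal_mul' maximal_is_ideal)
  next
    case False
    then show ?thesis
      using x that insert.prems by (auto intro!: is_ideal_mul maximal_is_ideal)
  qed
  moreover have "k \<star> x \<notin> M" using k x maximal_is_prime[OF M] by blast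
  ultimately show ?case by blast
qed

text \<open>
  The intersection of the maximal ideals treated so far is not contained in the next one, so it is
  comaximal with it, and the dimension formula for sums applies.
\<close>

lemma sum_codim_maximal:
  assumes "finite F" "F \<subseteq> Collect maximal_ideal"
  shows "(\<Sum>M\<in>F. codim M) + dim (\<Inter>F) = dim (UNIV :: 'a set)"
  using assms
proof (induction F rule: finite_induct)
  case (insert M F)
  have M: "maximal_ideal M" and F: "F \<subseteq> Collect maximal_ideal"
    using insert.prems by auto
  have I: "is_ideal (\<Inter>F)"
    using F maximal_is_ideal unfolding is_ideal_def
    by (auto intro!: subspace_Inter simp: is_ideal_def subset_iff)
  have "\<not> \<Inter>F \<subseteq> M" using prime_avoidance[OF M insert.hyps(1) F insert.hyps(2)] by blast
  then have "dim (UNIV :: 'a set) + dim (M \<inter> \<Inter>F) = dim M + dim (\<Inter>F)"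
    using fd.dim_sums_Int[of M "\<Inter>F"] maximal_sum_UNIV[OF M I] I M
    by (metis maximal_is_ideal is_ideal_subspace)
  moreover have "dim M \<le> dim (UNIV :: 'a set)" using fd.dim_subset[OF subset_UNIV] .
  ultimately show ?case
    using insert by (simp add: codim_def del: fd.dim_UNIV)
qed simp

lemma finite_maximal: "finite (Collect maximal_ideal)"
proof -
  have "card F \<le> dim (UNIV :: 'a set)" if "F \<subseteq> Collect maximal_ideal" "finite F" for F
  proof -
    have "card F = (\<Sum>M\<in>F. 1)" by simp
    also have "\<dots> \<le> (\<Sum>M\<in>F. codim M)"
      by (rule sum_mono) (use that codim_maximal in force)
    also have "\<dots> \<le> dim (UNIV :: 'a set)" using sum_codim_maximal[OF that(2,1)] by linarith
    finally show ?thesis .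
  qed
  then show ?thesis using finite_if_finite_subsets_card_bdd by blast
qed

text \<open>
  This is the Chinese remainder theorem: for each \<open>M\<close> there is an element that is \<open>1\<close> modulo \<open>M\<close> and lies
  in all other maximal ideals.
\<close>

lemma simultaneous_character_values:
  assumes z: "\<And>M. maximal_ideal M \<Longrightarrow> z M \<in> range (chi M)"
  shows "\<exists>c. \<forall>M. maximal_ideal M \<longrightarrow> chi M c = z M"
proof -
  have "\<exists>y. chi M y = z M \<and> (\<forall>K. maximal_ideal K \<longrightarrow> K \<noteq> M \<longrightarrow> chi K y = 0)"
    if M: "maximal_ideal M" for M
  proof -
    obtain x where x: "x \<in> \<Inter>(Collect maximal_ideal - {M})" "x \<notin> M"
      using prime_avoidance[OF M, of "Collect maximal_ideal - {M}"] finite_maximal by blast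
    \<comment> \<open>The element \<open>x \<star> w\<close> is \<open>1\<close> modulo \<open>M\<close> and \<open>0\<close> modulo every other maximal ideal.\<close>
    obtain w where w: "x \<star> w - e \<in> M" using inverse_modulo_maximal[OF M x(2)] by blast
    obtain y where y: "chi M y = z M" using z[OF M] by auto
    have "chi M (x \<star> w - e) = 0" using w chi_eq_0_iff[OF M] by blast
    then have "chi M (x \<star> w \<star> y) = z M"
      using y by (simp add: chi_mul[OF M] linear_diff[OF chi_linear[OF M]] M)
    moreover have "chi K (x \<star> w \<star> y) = 0" if K: "maximal_ideal K" "K \<noteq> M" for K
      using x(1) K by (auto simp: chi_mul chi_eq_0_iff)
    ultimately show ?thesis by blast
  qed
  then obtain y where y: "\<And>M. maximal_ideal M \<Longrightarrow> chi M (y M) = z M"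
    "\<And>M K. maximal_ideal M \<Longrightarrow> maximal_ideal K \<Longrightarrow> K \<noteq> M \<Longrightarrow> chi K (y M) = 0"
    by metis
  have "chi M (\<Sum>K\<in>Collect maximal_ideal. y K) = z M" if M: "maximal_ideal M" for M
  proof -
    have "chi M (\<Sum>K\<in>Collect maximal_ideal. y K) = (\<Sum>K\<in>Collect maximal_ideal. chi M (y K))"
      using linear_sum[OF chi_linear[OF M]] .
    also have "\<dots> = (\<Sum>K\<in>Collect maximal_ideal. if K = M then z M else 0)"
      by (rule sum.cong) (use y M in auto)
    also have "\<dots> = z M" using M finite_maximal by simp
    finally show ?thesis .
  qed
  then show ?thesis by blast
qed

text \<open>
  The multiples of a nonunit form a proper ideal.
\<close>

lemma units_iff: "x \<in> units \<longleftrightarrow> (\<forall>M. maximal_ideal M \<longrightarrow> x \<notin> M)"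
proof
  assume "x \<in> units"
  then obtain y where "x \<star> y = e" by (auto simp: units_def)
  then show "\<forall>M. maximal_ideal M \<longrightarrow> x \<notin> M"
    by (metis is_ideal_mul' maximal_is_ideal unit_notin_maximal)
next
  assume *: "\<forall>M. maximal_ideal M \<longrightarrow> x \<notin> M"
  have "x \<in> range (\<lambda>z. x \<star> z)" by (metis rangeI unit_right)
  then have "range (\<lambda>z. x \<star> z) = UNIV"
    using proper_ideal_in_maximal[OF principal_is_ideal, of x] * by blast
  then show "x \<in> units" unfolding units_def by (metis (mono_tags) UNIV_I mem_Collect_eq rangeE)
qed

end

section \<open>Connected components of the unit group\<close>

text \<open>
  The point \<open>a\<close> works unless \<open>a\<close> and \<open>b\<close> lie on opposite rays, and then the perpendicular direction \<open>\<i> * a\<close>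
  works.
\<close>

lemma common_point_avoiding_zero:
  fixes a b :: complex
  assumes "a \<noteq> 0" "b \<noteq> 0"
  shows "\<exists>z. 0 \<notin> closed_segment a z \<and> 0 \<notin> closed_segment b z"
proof (cases "0 \<in> closed_segment b a")
  case False
  then show ?thesis using assms(1) by (intro exI[of _ a]) auto
next
  case True
  then obtain u where u: "(1 - u) *\<^sub>R b + u *\<^sub>R a = 0"
    by (metis in_segment(1))
  have "u \<noteq> 1" using u assms(1) by auto
  then have "b = (1 / (1 - u)) *\<^sub>R ((1 - u) *\<^sub>R b)" by simp
  also have "(1 - u) *\<^sub>R b = - (u *\<^sub>R a)" using u by (simp add: eq_neg_iff_add_eq_0)
  finally have "b = complex_of_real (- u / (1 - u)) * a" by (simp add: scaleR_conv_of_real)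
  then obtain k where k: "b = complex_of_real k * a" ..
  have "0 \<notin> closed_segment (complex_of_real l * a) (\<i> * a)" if "l \<noteq> 0" for l
  proof
    assume "0 \<in> closed_segment (complex_of_real l * a) (\<i> * a)"
    then obtain t where "(1 - t) *\<^sub>R (complex_of_real l * a) + t *\<^sub>R (\<i> * a) = 0"
      by (metis in_segment(1))
    then have "(complex_of_real ((1 - t) * l) + complex_of_real t * \<i>) * a = 0"
      by (simp add: scaleR_conv_of_real algebra_simps)
    then have "complex_of_real ((1 - t) * l) + complex_of_real t * \<i> = 0"
      using assms(1) by simp
    then show False using that by (auto simp: complex_eq_iff)
  qed
  from this[of 1] this[of k] show ?thesis
    using k assms(2) by (intro exI[of _ "\<i> * a"]) auto
qed

lemma convex_open_halfspace:
  fixes f :: "'a::real_vector \<Rightarrow> real"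
  assumes f: "linear f"
  shows "convex {x. 0 < f x}"
proof -
  have "{x. 0 < f x} = f -` {0<..}" by auto
  then show ?thesis using convex_linear_vimage[OF f, of "{0<..}"] by simp
qed

lemma halfspace_is_component:
  fixes f :: "'a::real_normed_vector \<Rightarrow> real"
  assumes f: "linear f" "continuous_on UNIV f" and v: "0 < f v"
  shows "connected_component_set (- {x. f x = 0}) v = {x. 0 < f x}"
proof
  show "{x. 0 < f x} \<subseteq> connected_component_set (- {x. f x = 0}) v"
    by (rule connected_component_maximal)
       (use v convex_connected[OF convex_open_halfspace[OF f(1)]] in auto)
  show "connected_component_set (- {x. f x = 0}) v \<subseteq> {x. 0 < f x}"
  proof
    fix x assume "x \<in> connected_component_set (- {x. f x = 0}) v"
    then obtain S where S: "connected S" "S \<subseteq> - {x. f x = 0}" "v \<in> S" "x \<in> S"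
      by (auto simp: connected_component_def)
    have "connected (f ` S)"
      using connected_continuous_image[OF continuous_on_subset[OF f(2) subset_UNIV] S(1)] .
    then have "0 \<in> f ` S" if "f x \<le> 0"
      using connectedD_interval[of "f ` S" "f x" "f v" 0] S that v by auto
    then show "x \<in> {x. 0 < f x}" using S by force
  qed
qed

lemma closure_halfspace:
  fixes f :: "'a::real_normed_vector \<Rightarrow> real"
  assumes f: "linear f" "continuous_on UNIV f" and v: "0 < f v"
  shows "closure {x. 0 < f x} = {x. 0 \<le> f x}"
proof
  have "closed {x. 0 \<le> f x}"
    using closed_Collect_le[OF continuous_on_const f(2)] .
  then show "closure {x. 0 < f x} \<subseteq> {x. 0 \<le> f x}"
    by (intro closure_minimal) auto
  show "{x. 0 \<le> f x} \<subseteq> closure {x. 0 < f x}"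
  proof
    fix x assume x: "x \<in> {x. 0 \<le> f x}"
    have "(\<lambda>n. x + inverse (real (Suc n)) *\<^sub>R v) \<longlonglongrightarrow> x + 0 *\<^sub>R v"
      by (intro tendsto_intros LIMSEQ_inverse_real_of_nat)
    moreover have "x + inverse (real (Suc n)) *\<^sub>R v \<in> {x. 0 < f x}" for n
      using x v by (simp add: linear_add[OF f(1)] linear_scale[OF f(1)] add_nonneg_pos)
    ultimately show "x \<in> closure {x. 0 < f x}"
      unfolding closure_sequential by (metis (no_types, lifting) add.right_neutral scaleR_zero_left)
  qed
qed

context findim_comm_algebra
begin

definition real_maximal :: "'a set \<Rightarrow> bool" where
  "real_maximal M \<longleftrightarrow> maximal_ideal M \<and> codim M = 1"

text \<open>
  This is the set of units on which every real character has the same sign as at \<open>v\<close>; it will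
  turn out to be the connected component of \<open>v\<close> among the units.
\<close>

definition sign_class :: "'a \<Rightarrow> 'a set" where
  "sign_class v = {x \<in> units. \<forall>M. real_maximal M \<longrightarrow> 0 < Re (chi M x) * Re (chi M v)}"

lemma real_maximalD: "real_maximal M \<Longrightarrow> maximal_ideal M" "real_maximal M \<Longrightarrow> codim M = 1"
  by (auto simp: real_maximal_def)

lemma chi_nonzero: "maximal_ideal M \<Longrightarrow> x \<in> units \<Longrightarrow> chi M x \<noteq> 0"
  by (simp add: chi_eq_0_iff units_iff)

lemma units_iff_chi: "x \<in> units \<longleftrightarrow> (\<forall>M. maximal_ideal M \<longrightarrow> chi M x \<noteq> 0)"
  by (simp add: chi_eq_0_iff units_iff)

lemma Re_chi_eq_0_iff: "real_maximal M \<Longrightarrow> Re (chi M x) = 0 \<longleftrightarrow> x \<in> M"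
  by (metis chi_codim1 chi_eq_0_iff of_real_0 real_maximalD zero_complex.sel(1))

lemma Re_chi_mul: "real_maximal M \<Longrightarrow> Re (chi M (x \<star> y)) = Re (chi M x) * Re (chi M y)"
  using chi_codim1[of M x] chi_mul[of M x y] real_maximalD[of M]
  by (metis Im_complex_of_real diff_zero mult_zero_left times_complex.sel(1))

lemma linear_Re_chi_mult:
  assumes M: "maximal_ideal M"
  shows "linear (\<lambda>x. Re (chi M x) * k)"
  by (intro linearI)
     (simp_all add: linear_add[OF chi_linear[OF M]] linear_scale[OF chi_linear[OF M]] algebra_simps)

lemmas continuous_Re_chi_mult = linear_imp_continuous_on[OF linear_Re_chi_mult]

lemma e_in_units: "e \<in> units"
  by (auto simp: units_def)

lemma units_mul: "x \<in> units \<Longrightarrow> y \<in> units \<Longrightarrow> x \<star> y \<in> units"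
  by (simp add: units_iff_chi chi_mul)

lemma units_inverse:
  assumes "x \<in> units"
  obtains y where "x \<star> y = e" "y \<star> x = e" "y \<in> units"
  using assms comm unfolding units_def by blast

lemma open_units: "open units"
proof -
  have "units = (\<Inter>M\<in>Collect maximal_ideal. {x. chi M x \<noteq> 0})"
    by (auto simp: units_iff_chi)
  also have "open \<dots>"
    by (intro open_INT finite_maximal ballI open_Collect_neq continuous_on_chi continuous_on_const) auto
  finally show ?thesis .
qed

lemma open_sign_class: "open (sign_class v)"
proof -
  have fin: "finite (Collect real_maximal)"
    by (rule finite_subset[OF _ finite_maximal]) (auto simp: real_maximal_def)
  have "sign_class v = units \<inter> (\<Inter>M\<in>Collect real_maximal. {x. 0 < Re (chi M x) * Re (chi M v)})"
    by (auto simp: sign_class_def)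
  also have "open \<dots>"
    by (intro open_Int open_units open_INT fin ballI open_Collect_less continuous_on_const
        continuous_Re_chi_mult) (auto simp: real_maximal_def)
  finally show ?thesis .
qed

lemma sign_class_refl: "v \<in> units \<Longrightarrow> v \<in> sign_class v"
  using Re_chi_eq_0_iff[of _ v] real_maximalD(1)
  by (auto simp: sign_class_def units_iff zero_less_mult_iff linorder_neq_iff)

lemma sign_class_mul:
  assumes "y \<in> sign_class e" "v \<in> units"
  shows "y \<star> v \<in> sign_class v"
proof -
  have "0 < Re (chi M (y \<star> v)) * Re (chi M v)" if M: "real_maximal M" for M
  proof -
    have "0 < Re (chi M y)"
      using assms(1) M by (auto simp: sign_class_def real_maximal_def)
    moreover have "0 < Re (chi M v) * Re (chi M v)"
      using sign_class_refl[OF assms(2)] M by (auto simp: sign_class_def)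
    ultimately show ?thesis
      using M by (simp add: Re_chi_mul mult.assoc)
  qed
  then show ?thesis using assms by (auto simp: sign_class_def units_mul)
qed

lemma sign_class_eq_coset:
  assumes v: "v \<in> units"
  shows "sign_class v = (\<lambda>y. y \<star> v) ` sign_class e"
proof
  show "(\<lambda>y. y \<star> v) ` sign_class e \<subseteq> sign_class v"
    using sign_class_mul[OF _ v] by blast
  show "sign_class v \<subseteq> (\<lambda>y. y \<star> v) ` sign_class e"
  proof
    fix x assume x: "x \<in> sign_class v"
    obtain w where w: "v \<star> w = e" "w \<star> v = e" "w \<in> units" using units_inverse[OF v] .
    have "x \<star> w \<in> sign_class e"
    proof -
      have "0 < Re (chi M (x \<star> w)) * Re (chi M e)" if M: "real_maximal M" for M
      proof -
        have pos: "0 < Re (chi M x) * Re (chi M v)"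
          using x M by (auto simp: sign_class_def)
        have "Re (chi M v) * Re (chi M w) = 1"
          using w(1) M by (metis Re_chi_mul chi_unit one_complex.sel(1) real_maximalD(1))
        with pos have "0 < Re (chi M x) * Re (chi M w)"
          by (smt (verit) mult_neg_neg mult_pos_pos zero_less_mult_iff)
        then show ?thesis using M by (simp add: Re_chi_mul real_maximalD)
      qed
      then show ?thesis using x w(3) by (auto simp: sign_class_def units_mul)
    qed
    moreover have "x \<star> w \<star> v = x" by (simp add: assoc w(2))
    ultimately show "x \<in> (\<lambda>y. y \<star> v) ` sign_class e" by (metis imageI)
  qed
qed

text \<open>
  Two elements \<open>v\<close> and \<open>x\<close> are joined by the two segments through a point \<open>c\<close> that is chosen by its
  characters: a real character has the same value at \<open>c\<close> as at \<open>v\<close>, so it keeps its sign on both segments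
  by convexity, and a complex character takes a value that both segments reach without meeting zero.
\<close>

lemma connected_sign_class:
  assumes v: "v \<in> units"
  shows "connected (sign_class v)"
proof -
  have "connected_component (sign_class v) v x" if x: "x \<in> sign_class v" for x
  proof -
    have xu: "x \<in> units" using x by (simp add: sign_class_def)
    have "\<exists>z. z \<in> range (chi M) \<and> (codim M = 1 \<longrightarrow> z = chi M v) \<and>
        (codim M \<noteq> 1 \<longrightarrow> 0 \<notin> closed_segment (chi M v) z \<and> 0 \<notin> closed_segment (chi M x) z)"
      if M: "maximal_ideal M" for M
    proof (cases "codim M = 1")
      case False
      then show ?thesis
        using common_point_avoiding_zero[of "chi M v" "chi M x"] chi_nonzero[OF M] v xu
          chi_range_not_codim1[OF M] by simp
    qed auto
    then obtain z where z: "\<And>M. maximal_ideal M \<Longrightarrow> z M \<in> range (chi M)"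
      "\<And>M. maximal_ideal M \<Longrightarrow> codim M = 1 \<Longrightarrow> z M = chi M v"
      "\<And>M. maximal_ideal M \<Longrightarrow> codim M \<noteq> 1 \<Longrightarrow> 0 \<notin> closed_segment (chi M v) (z M)"
      "\<And>M. maximal_ideal M \<Longrightarrow> codim M \<noteq> 1 \<Longrightarrow> 0 \<notin> closed_segment (chi M x) (z M)"
      by metis
    obtain c where c: "\<And>M. maximal_ideal M \<Longrightarrow> chi M c = z M"
      using simultaneous_character_values[OF z(1)] by blast
    have seg: "closed_segment y c \<subseteq> sign_class v"
      if y: "y \<in> sign_class v"
        and avoid: "\<And>M. maximal_ideal M \<Longrightarrow> codim M \<noteq> 1 \<Longrightarrow> 0 \<notin> closed_segment (chi M y) (z M)"
      for y
    proof
      fix w assume w: "w \<in> closed_segment y c"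
      have pos: "0 < Re (chi M w) * Re (chi M v)" if M: "real_maximal M" for M
      proof -
        have "closed_segment y c \<subseteq> {x. 0 < Re (chi M x) * Re (chi M v)}"
        proof (rule closed_segment_subset)
          show "convex {x. 0 < Re (chi M x) * Re (chi M v)}"
            using convex_open_halfspace[OF linear_Re_chi_mult] M real_maximalD by blast
          show "y \<in> {x. 0 < Re (chi M x) * Re (chi M v)}"
            using y M by (auto simp: sign_class_def)
          have "chi M c = chi M v" using c z(2) M real_maximalD by metis
          then show "c \<in> {x. 0 < Re (chi M x) * Re (chi M v)}"
            using sign_class_refl[OF v] M by (auto simp: sign_class_def)
        qed
        then show ?thesis using w by blast
      qed
      have "chi M w \<noteq> 0" if M: "maximal_ideal M" for M
      proof (cases "codim M = 1")
        case True
        then show ?thesis using pos[of M] M by (auto simp: real_maximal_def)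
      next
        case False
        have "chi M w \<in> closed_segment (chi M y) (z M)"
          using w closed_segment_linear_image[OF chi_linear[OF M], of y c] c[OF M] by auto
        then show ?thesis using avoid[OF M False] by auto
      qed
      then show "w \<in> sign_class v" using pos by (auto simp: sign_class_def units_iff_chi)
    qed
    have "connected_component (sign_class v) v c"
      using seg[OF sign_class_refl[OF v] z(3)] connected_segment(1)
      unfolding connected_component_def by (metis ends_in_segment)
    moreover have "connected_component (sign_class v) x c"
      using seg[OF x z(4)] connected_segment(1)
      unfolding connected_component_def by (metis ends_in_segment)
    ultimately show ?thesis
      using connected_component_trans connected_component_sym by metis
  qed
  then show ?thesis
    unfolding connected_iff_connected_component
    using connected_component_trans connected_component_sym by metis
qed

text \<open>
  A real character has no zeros among the units, so it cannot change its sign on a connected set of units.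
\<close>

lemma component_of_units:
  assumes v: "v \<in> units"
  shows "connected_component_set units v = sign_class v"
proof
  show "sign_class v \<subseteq> connected_component_set units v"
    by (rule connected_component_maximal)
       (use v connected_sign_class sign_class_refl in \<open>auto simp: sign_class_def\<close>)
  show "connected_component_set units v \<subseteq> sign_class v"
  proof
    fix x assume x: "x \<in> connected_component_set units v"
    have "0 < Re (chi M x) * Re (chi M v)" if M: "real_maximal M" for M
    proof -
      let ?f = "\<lambda>x. Re (chi M x) * Re (chi M v)"
      have vpos: "0 < ?f v"
        using sign_class_refl[OF v] M by (auto simp: sign_class_def)
      have "units \<subseteq> - {x. ?f x = 0}"
        using v real_maximalD(1)[OF M] by (auto simp: Re_chi_eq_0_iff[OF M] units_iff)
      then have "x \<in> connected_component_set (- {x. ?f x = 0}) v"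
        using x connected_component_mono by blast
      then show ?thesis
        using halfspace_is_component[of ?f v] linear_Re_chi_mult continuous_Re_chi_mult
          M real_maximalD vpos by blast
    qed
    then show "x \<in> sign_class v"
      using x connected_component_subset by (fastforce simp: sign_class_def)
  qed
qed

text \<open>
  If \<open>x\<close> satisfies the weak sign conditions, then \<open>x + t v\<close> satisfies the strict ones for \<open>t > 0\<close>, and for all
  small \<open>t > 0\<close> no character vanishes on it: near a nonzero value by continuity, and near zero because the
  value is \<open>t\<close> times that at \<open>v\<close>.
\<close>

lemma closure_sign_class:
  assumes v: "v \<in> units"
  shows "closure (sign_class v) = {x. \<forall>M. real_maximal M \<longrightarrow> 0 \<le> Re (chi M x) * Re (chi M v)}"
    (is "_ = ?C")
proof
  have "?C = (\<Inter>M\<in>Collect real_maximal. {x. 0 \<le> Re (chi M x) * Re (chi M v)})" by auto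
  also have "closed \<dots>"
    by (intro closed_INT ballI closed_Collect_le continuous_on_const continuous_Re_chi_mult)
       (auto simp: real_maximal_def)
  finally show "closure (sign_class v) \<subseteq> ?C"
    by (intro closure_minimal) (auto simp: sign_class_def intro: less_imp_le)
  show "?C \<subseteq> closure (sign_class v)"
  proof
    fix x assume x: "x \<in> ?C"
    have lim: "((\<lambda>t. x + t *\<^sub>R v) \<longlongrightarrow> x) (at_right (0::real))"
      by (rule tendsto_eq_intros | simp)+
    have "eventually (\<lambda>t. chi M (x + t *\<^sub>R v) \<noteq> 0) (at_right (0::real))"
      if M: "maximal_ideal M" for M
    proof (cases "chi M x = 0")
      case True
      have "eventually (\<lambda>t::real. t > 0) (at_right 0)" by (simp add: eventually_at_right_less)
      then show ?thesis
        by eventually_elim (simp add: linear_add[OF chi_linear[OF M]]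
            linear_scale[OF chi_linear[OF M]] True chi_nonzero[OF M v])
    next
      case False
      have "((\<lambda>t. chi M (x + t *\<^sub>R v)) \<longlongrightarrow> chi M x) (at_right (0::real))"
        by (rule continuous_on_tendsto_compose[OF continuous_on_chi[OF M, of UNIV] lim]) auto
      then show ?thesis using False by (rule tendsto_imp_eventually_ne)
    qed
    then have "eventually (\<lambda>t. \<forall>M\<in>Collect maximal_ideal. chi M (x + t *\<^sub>R v) \<noteq> 0) (at_right (0::real))"
      using finite_maximal by (intro eventually_ball_finite) auto
    moreover have "eventually (\<lambda>t::real. t > 0) (at_right 0)" by (simp add: eventually_at_right_less)
    ultimately have ev: "eventually (\<lambda>t. x + t *\<^sub>R v \<in> sign_class v) (at_right (0::real))"
    proof eventually_elim
      case (elim t)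
      have "0 < Re (chi M (x + t *\<^sub>R v)) * Re (chi M v)" if M: "real_maximal M" for M
      proof -
        have "0 \<le> Re (chi M x) * Re (chi M v)" using x M by auto
        moreover have "0 < Re (chi M v) * Re (chi M v)"
          using sign_class_refl[OF v] M by (auto simp: sign_class_def)
        then have "0 < t * (Re (chi M v) * Re (chi M v))" using elim by simp
        moreover note chi_linear[OF real_maximalD(1)[OF M]]
        ultimately show ?thesis
          by (simp add: linear_add linear_scale algebra_simps)
      qed
      then show ?case using elim by (auto simp: sign_class_def units_iff_chi)
    qed
    have "eventually (\<lambda>t. x + t *\<^sub>R v \<in> closure (sign_class v)) (at_right (0::real))"
      using ev by (rule eventually_mono) (rule subsetD[OF closure_subset])
    then show "x \<in> closure (sign_class v)"
      by (rule Lim_in_closed_set[OF closed_closure _ _ lim]) simp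
  qed
qed

lemma span_sign_class: "span (sign_class e) = UNIV"
  using span_eq_UNIV_if_interior[of "sign_class e"] open_sign_class[of e]
    sign_class_refl[OF e_in_units] by (auto simp: interior_open)

lemma halfspaces_of_real_maximal:
  assumes M: "real_maximal M" and v: "v \<in> units"
  shows "\<exists>!C. C \<in> open_half_spaces M \<and> v \<in> C"
    and "closure (THE C. C \<in> open_half_spaces M \<and> v \<in> C) = {x. 0 \<le> Re (chi M x) * Re (chi M v)}"
proof -
  let ?f = "\<lambda>x. Re (chi M x) * Re (chi M v)"
  note f = linear_Re_chi_mult[OF real_maximalD(1)[OF M], of "Re (chi M v)"]
    continuous_Re_chi_mult[OF real_maximalD(1)[OF M], of UNIV "Re (chi M v)"]
  have vM: "v \<notin> M" using v M by (auto simp: units_iff real_maximal_def)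
  have vpos: "0 < ?f v"
    using sign_class_refl[OF v] M by (auto simp: sign_class_def)
  have "{x. ?f x = 0} = M"
    using vM M by (auto simp: Re_chi_eq_0_iff)
  then have comp: "connected_component_set (- M) v = {x. 0 < ?f x}"
    using halfspace_is_component[OF f vpos] by simp
  have uniq: "C \<in> open_half_spaces M \<and> v \<in> C \<longleftrightarrow> C = {x. 0 < ?f x}" for C
  proof
    assume "C \<in> open_half_spaces M \<and> v \<in> C"
    then show "C = {x. 0 < ?f x}"
      unfolding comp[symmetric] open_half_spaces_def components_def
      using connected_component_eq by fastforce
  next
    assume C: "C = {x. 0 < ?f x}"
    have "connected_component_set (- M) v \<in> components (- M)"
      using vM by (simp add: componentsI)
    then show "C \<in> open_half_spaces M \<and> v \<in> C"
      using C vpos by (simp add: comp open_half_spaces_def)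
  qed
  then show "\<exists>!C. C \<in> open_half_spaces M \<and> v \<in> C" by simp
  have "(THE C. C \<in> open_half_spaces M \<and> v \<in> C) = {x. 0 < ?f x}"
    using uniq by simp
  then show "closure (THE C. C \<in> open_half_spaces M \<and> v \<in> C) = {x. 0 \<le> ?f x}"
    using closure_halfspace[OF f vpos] by simp
qed

context
  fixes S
  assumes e_S: "e \<in> S"
    and mul_S: "\<And>x y. x \<in> S \<Longrightarrow> y \<in> S \<Longrightarrow> x \<star> y \<in> S"
    and inv_S: "\<And>x. x \<in> S \<Longrightarrow> \<exists>y\<in>S. x \<star> y = e"
begin

lemma subgroup_subset_units: "S \<subseteq> units"
  using inv_S by (auto simp: units_def)

lemma open_preimage_mul: "open T \<Longrightarrow> open {w. z \<star> w \<in> T}"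
  using open_vimage[OF _ linear_imp_continuous_on[OF linear_mul_left], of T z]
  by (simp add: vimage_def)

text \<open>
  Translations by units are homeomorphisms.
\<close>

lemma open_subgroup_if_interior:
  assumes "interior S \<noteq> {}"
  shows "open S"
proof (subst open_subopen, intro ballI)
  fix x assume x: "x \<in> S"
  obtain y where y: "y \<in> interior S" using assms by blast
  obtain w where w: "w \<in> S" "x \<star> w = e" using inv_S[OF x] by blast
  have z: "y \<star> w \<in> S" using y w mul_S interior_subset by blast
  obtain z' where z': "z' \<in> S" "(y \<star> w) \<star> z' = e" using inv_S[OF z] by blast
  let ?T = "{u. (y \<star> w) \<star> u \<in> interior S}"
  have "y \<star> w \<star> x = y" using w(2) by (simp add: assoc comm[of w x])
  then have "x \<in> ?T" using y by simp
  moreover have "?T \<subseteq> S"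
  proof
    fix u assume "u \<in> ?T"
    then have "z' \<star> ((y \<star> w) \<star> u) \<in> S" using z'(1) mul_S interior_subset by blast
    also have "z' \<star> ((y \<star> w) \<star> u) = u"
      using z'(2) by (metis assoc comm unit_left)
    finally show "u \<in> S" .
  qed
  ultimately show "\<exists>T. open T \<and> x \<in> T \<and> T \<subseteq> S"
    using open_preimage_mul[OF open_interior] by blast
qed

text \<open>
  The complement of an open subgroup is a union of open cosets.
\<close>

lemma identity_component_subset_open_subgroup:
  assumes S: "open S"
  shows "sign_class e \<subseteq> S"
proof -
  have "open (units - S)"
  proof (subst open_subopen, intro ballI)
    fix u assume u: "u \<in> units - S"
    then obtain w where w: "u \<star> w = e" "w \<star> u = e" "w \<in> units" using units_inverse[of u] by blast
    \<comment> \<open>This is the coset of \<open>u\<close>, written as a preimage.\<close>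
    let ?T = "{x. w \<star> x \<in> S}"
    have "?T \<subseteq> units - S"
    proof
      fix x assume x: "x \<in> ?T"
      then have wx: "w \<star> x \<in> S" by simp
      have "x = u \<star> (w \<star> x)" by (metis assoc unit_left w(1))
      then have "x \<in> units" using units_mul u wx subgroup_subset_units by (metis DiffD1 subsetD)
      moreover have "x \<notin> S"
      proof
        assume "x \<in> S"
        then obtain x' where x': "x' \<in> S" "x \<star> x' = e" using inv_S by blast
        have "w \<star> x \<star> x' \<in> S" using wx x' mul_S by blast
        then have "w \<in> S" using x' by (simp add: assoc)
        then obtain w' where w': "w' \<in> S" "w \<star> w' = e" using inv_S by blast
        then have "w' = u" by (metis assoc unit_left unit_right w(1))
        then show False using w' u by simp
      qed
      ultimately show "x \<in> units - S" by blast
    qed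
    then show "\<exists>T. open T \<and> u \<in> T \<and> T \<subseteq> units - S"
      using open_preimage_mul[OF S, of w] w(2) e_S by (intro exI[of _ ?T]) auto
  qed
  moreover have "sign_class e \<subseteq> S \<union> (units - S)" by (auto simp: sign_class_def)
  moreover have "e \<in> S \<inter> sign_class e" using e_S sign_class_refl[OF e_in_units] by blast
  ultimately show ?thesis
    using connectedD[OF connected_sign_class[OF e_in_units] S, of "units - S"] by blast
qed

end

end

section \<open>Abelian linear groups with an open orbit\<close>

lemma real_analytic_on_if_linear_extension:
  fixes F :: "'a::real_normed_vector \<Rightarrow> 'b::real_normed_vector"
  assumes fd: "\<exists>B::'a set. finite B \<and> span B = UNIV"
    and F: "linear F" and eq: "\<And>x. x \<in> S \<Longrightarrow> f x = F x"
  shows "real_analytic_on f S"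
proof -
  obtain B :: "'a set" where "findim_space B" using findim_spaceE[OF fd] .
  then have "real_analytic_at F y" for y
    using findim_space.linear_real_analytic_at[OF _ F] by blast
  then show ?thesis
    unfolding real_analytic_on_def using eq by (intro ballI exI[of _ UNIV] exI[of _ F]) auto
qed

text \<open>
  On the line through \<open>x\<close> and a point of the open set, the function is a polynomial in one variable with
  infinitely many zeros.
\<close>

lemma real_polynomial_vanishing_on_open:
  fixes p :: "'a::real_normed_vector \<Rightarrow> real"
  assumes p: "real_polynomial_function p"
    and S: "open S" "y \<in> S" "\<And>x. x \<in> S \<Longrightarrow> p x = 0"
  shows "p x = 0"
proof -
  define l where "l t = y + t *\<^sub>R (x - y)" for t :: real
  have "polynomial_function l"
    unfolding l_def
    by (intro polynomial_function_add polynomial_function_const polynomial_function_bounded_linear)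
       (rule bounded_linear_scaleR_left)
  then have "real_polynomial_function (p \<circ> l)"
    using p by (rule real_polynomial_function_compose)
  then obtain a n where an: "p \<circ> l = (\<lambda>t. \<Sum>i\<le>n. a i * t ^ i)"
    by (auto simp: real_polynomial_function_iff_sum)
  have "open (l -` S)"
    unfolding l_def by (intro open_vimage S(1) continuous_intros)
  moreover have "0 \<in> l -` S" using S(2) by (simp add: l_def)
  ultimately have "infinite (l -` S)"
    using infinite_openin[of UNIV "l -` S" 0] islimpt_UNIV[of "0::real"] by auto
  moreover have "l -` S \<subseteq> {t. (\<Sum>i\<le>n. a i * t ^ i) = 0}"
    using S(3) by (auto simp flip: fun_cong[OF an, unfolded o_def])
  ultimately have "infinite {t. (\<Sum>i\<le>n. a i * t ^ i) = 0}"
    using finite_subset by blast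
  then have "\<forall>i\<le>n. a i = 0" using polyfun_finite_roots[of a n] by blast
  then have "(p \<circ> l) 1 = 0" unfolding an by simp
  then show ?thesis by (simp add: l_def)
qed

lemma blinfun_compose_assoc: "(a o\<^sub>L b) o\<^sub>L c = a o\<^sub>L (b o\<^sub>L c)"
  by (rule blinfun_eqI) simp

lemmas blinfun_compose_linear =
  bounded_bilinear.add_left[OF bounded_bilinear_blinfun_compose]
  bounded_bilinear.add_right[OF bounded_bilinear_blinfun_compose]
  bounded_bilinear.scaleR_left[OF bounded_bilinear_blinfun_compose]
  bounded_bilinear.scaleR_right[OF bounded_bilinear_blinfun_compose]

text \<open>
  The inverse of a bijective endomorphism is again bounded, as every linear map is.
\<close>

lemma (in findim_space) group_GL: "group (GL :: ('a \<Rightarrow>\<^sub>L 'a) monoid)"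
proof (rule groupI)
  fix g :: "'a \<Rightarrow>\<^sub>L 'a" assume "g \<in> carrier GL"
  then have g: "bij (blinfun_apply g)" by (simp add: GL_def)
  define h where "h = Blinfun (inv_into UNIV (blinfun_apply g))"
  let ?i = "inv_into UNIV (blinfun_apply g)"
  have gi: "blinfun_apply g (?i x) = x" and ig: "?i (blinfun_apply g x) = x" for x
    using g by (simp_all add: bij_is_surj bij_is_inj surj_f_inv_f)
  have lin: "linear ?i"
  proof (rule linearI)
    fix x y :: 'a and c :: real
    show "?i (x + y) = ?i x + ?i y"
      using ig[of "?i x + ?i y"] by (simp add: blinfun.add_right gi)
    show "?i (c *\<^sub>R x) = c *\<^sub>R ?i x"
      using ig[of "c *\<^sub>R ?i x"] by (simp add: blinfun.scaleR_right gi)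
  qed
  have h: "blinfun_apply h = inv_into UNIV (blinfun_apply g)"
    unfolding h_def by (rule bounded_linear_Blinfun_apply[OF linear_imp_bounded_linear[OF lin]])
  have "h \<in> carrier GL" by (simp add: GL_def h bij_imp_bij_inv g)
  moreover have "h o\<^sub>L g = id_blinfun"
    by (rule blinfun_eqI) (simp add: h g bij_is_inj)
  ultimately show "\<exists>y\<in>carrier GL. y \<otimes>\<^bsub>GL\<^esub> g = \<one>\<^bsub>GL\<^esub>" by (auto simp: GL_def)
qed (auto simp: GL_def blinfun_compose_assoc blinfun_compose.rep_eq bij_id[unfolded id_def]
    intro: bij_comp blinfun_eqI)

locale abelian_group_with_open_orbit = findim_space B for B :: "'a::real_normed_vector set" +
  fixes Gs :: "('a \<Rightarrow>\<^sub>L 'a) set" and e :: 'a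
  assumes subgroup_Gs: "subgroup Gs GL"
    and commute: "g \<in> Gs \<Longrightarrow> h \<in> Gs \<Longrightarrow> g o\<^sub>L h = h o\<^sub>L g"
    and interior_orbit: "interior (orbit Gs e) \<noteq> {}"
begin

definition centralizer :: "('a \<Rightarrow>\<^sub>L 'a) set" where
  "centralizer = {a. \<forall>g\<in>Gs. a o\<^sub>L g = g o\<^sub>L a}"

lemma subspace_centralizer: "subspace centralizer"
  by (auto simp: centralizer_def subspace_def blinfun_compose_linear)

lemma centralizer_compose: "a \<in> centralizer \<Longrightarrow> b \<in> centralizer \<Longrightarrow> a o\<^sub>L b \<in> centralizer"
  by (simp add: centralizer_def) (metis blinfun_compose_assoc)

lemma id_in_centralizer: "id_blinfun \<in> centralizer"
  by (auto simp: centralizer_def intro: blinfun_eqI)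

text \<open>
  Both sides agree at \<open>g e\<close> for each \<open>g \<in> Gs\<close>, and these points span the space.
\<close>

lemma centralizer_eqI:
  assumes a: "a \<in> centralizer" and b: "b \<in> centralizer" and eq: "blinfun_apply a e = blinfun_apply b e"
  shows "a = b"
proof (rule blinfun_eqI)
  fix x
  have "x \<in> span (orbit Gs e)" using span_eq_UNIV_if_interior[OF interior_orbit] by simp
  then show "blinfun_apply a x = blinfun_apply b x"
  proof (rule linear_eq_on[rotated 2])
    fix y assume "y \<in> orbit Gs e"
    then obtain g where g: "g \<in> Gs" "y = blinfun_apply g e" by (auto simp: orbit_def)
    have "blinfun_apply (a o\<^sub>L g) e = blinfun_apply (b o\<^sub>L g) e"
      using a b g(1) eq by (simp add: centralizer_def)
    then show "blinfun_apply a y = blinfun_apply b y" by (simp add: g(2))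
  qed (simp_all add: bounded_linear.linear blinfun.bounded_linear_right)
qed

lemma Gs_subset_centralizer: "Gs \<subseteq> centralizer"
  using commute by (auto simp: centralizer_def)

lemma span_Gs_subset_centralizer: "span Gs \<subseteq> centralizer"
  using span_minimal[OF Gs_subset_centralizer subspace_centralizer] .

lemma span_Gs_commute:
  assumes "a \<in> span Gs" "b \<in> centralizer"
  shows "a o\<^sub>L b = b o\<^sub>L a"
  using assms(1)
proof (induction rule: span_induct)
  case base
  then show ?case
    by (auto simp: subspace_def blinfun_compose_linear)
next
  case (step g)
  then show ?case using assms(2) by (simp add: centralizer_def)
qed

lemma evaluation_surj: "\<exists>a\<in>span Gs. blinfun_apply a e = x"
proof -
  have "linear (\<lambda>a. blinfun_apply a e)"
    by (simp add: bounded_linear.linear blinfun.bounded_linear_left)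
  then have "span (orbit Gs e) = (\<lambda>a. blinfun_apply a e) ` span Gs"
    unfolding orbit_def by (rule linear_span_image)
  then show ?thesis using span_eq_UNIV_if_interior[OF interior_orbit] by (metis UNIV_I imageE)
qed

text \<open>
  This is the inverse of evaluation at \<open>e\<close> on the span of \<open>Gs\<close>; it turns a vector into the
  multiplication by this vector.
\<close>

definition mult_op :: "'a \<Rightarrow> ('a \<Rightarrow>\<^sub>L 'a)" where
  "mult_op x = (SOME a. a \<in> span Gs \<and> blinfun_apply a e = x)"

definition mul :: "'a \<Rightarrow> 'a \<Rightarrow> 'a" (infixl "\<star>" 70) where
  "x \<star> y = blinfun_apply (mult_op x) y"

lemma mult_op_span: "mult_op x \<in> span Gs" and mult_op_e [simp]: "blinfun_apply (mult_op x) e = x"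
proof -
  have "\<exists>a. a \<in> span Gs \<and> blinfun_apply a e = x" using evaluation_surj by blast
  from someI_ex[OF this] show "mult_op x \<in> span Gs" "blinfun_apply (mult_op x) e = x"
    unfolding mult_op_def by blast+
qed

lemma mult_op_centralizer: "mult_op x \<in> centralizer"
  using mult_op_span span_Gs_subset_centralizer by blast

lemma mult_op_eq: "a \<in> centralizer \<Longrightarrow> mult_op (blinfun_apply a e) = a"
  by (rule centralizer_eqI[OF mult_op_centralizer]) auto

lemma mult_op_eqI: "a \<in> centralizer \<Longrightarrow> blinfun_apply a e = x \<Longrightarrow> mult_op x = a"
  using mult_op_eq by auto

lemma mult_op_unit: "mult_op e = id_blinfun"
  by (rule mult_op_eqI[OF id_in_centralizer]) simp

lemma mult_op_mul: "mult_op (x \<star> y) = mult_op x o\<^sub>L mult_op y"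
  by (rule mult_op_eqI[OF centralizer_compose[OF mult_op_centralizer mult_op_centralizer]])
     (simp add: mul_def)

lemma linear_mult_op: "linear mult_op"
proof (rule linearI)
  fix x y :: 'a and c :: real
  show "mult_op (x + y) = mult_op x + mult_op y"
    by (rule mult_op_eqI) (auto intro: subspace_add subspace_centralizer mult_op_centralizer simp: blinfun.add_left)
  show "mult_op (c *\<^sub>R x) = c *\<^sub>R mult_op x"
    by (rule mult_op_eqI) (auto intro: subspace_scale subspace_centralizer mult_op_centralizer simp: blinfun.scaleR_left)
qed

text \<open>
  Associativity comes from the uniqueness of elements of the centralizer with a given value at \<open>e\<close>,
  commutativity from the fact that the span of \<open>Gs\<close> commutes with the centralizer.
\<close>

sublocale findim_comm_algebra B mul e
proof
  fix x y z :: 'a and c :: real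
  show "(x + y) \<star> z = x \<star> z + y \<star> z"
    by (simp add: mul_def linear_add[OF linear_mult_op] blinfun.add_left)
  show "(c *\<^sub>R x) \<star> y = c *\<^sub>R (x \<star> y)"
    by (simp add: mul_def linear_scale[OF linear_mult_op] blinfun.scaleR_left)
  show "(x \<star> y) \<star> z = x \<star> (y \<star> z)"
    by (simp add: mul_def[of "x \<star> y"] mult_op_mul) (simp add: mul_def)
  show "e \<star> x = x"
    by (simp add: mul_def mult_op_unit)
  have "blinfun_apply (mult_op x o\<^sub>L mult_op y) e = blinfun_apply (mult_op y o\<^sub>L mult_op x) e"
    using span_Gs_commute[OF mult_op_span mult_op_centralizer] by metis
  then show "x \<star> y = y \<star> x" by (simp add: mul_def)
qed

lemma continuous_on_mult_op: "continuous_on S mult_op"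
  using linear_imp_continuous_on[OF linear_mult_op] .

lemma continuous_on_evaluation: "continuous_on S (\<lambda>g. blinfun_apply g (v :: 'a))"
  by (intro continuous_intros)

lemma mult_op_GL_iff: "mult_op x \<in> carrier GL \<longleftrightarrow> x \<in> units"
proof
  assume "mult_op x \<in> carrier GL"
  then have "surj (blinfun_apply (mult_op x))" by (simp add: GL_def bij_def)
  then show "x \<in> units" unfolding units_def mul_def by (metis (mono_tags) mem_Collect_eq surjD)
next
  assume "x \<in> units"
  then obtain y where y: "x \<star> y = e" "y \<star> x = e" using units_inverse by blast
  have "blinfun_apply (mult_op x) (blinfun_apply (mult_op y) z) = z"
    "blinfun_apply (mult_op y) (blinfun_apply (mult_op x) z) = z" for z
    using arg_cong[OF y(1), of "\<lambda>w. w \<star> z"] arg_cong[OF y(2), of "\<lambda>w. w \<star> z"]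
    by (simp_all add: assoc flip: mul_def)
  then have "bij (blinfun_apply (mult_op x))" by (intro o_bij[of "blinfun_apply (mult_op y)"]) auto
  then show "mult_op x \<in> carrier GL" by (simp add: GL_def)
qed

lemma Gs_eq: "Gs = mult_op ` orbit Gs e"
  using Gs_subset_centralizer mult_op_eq by (force simp: orbit_def image_image)

lemma e_in_orbit: "e \<in> orbit Gs e"
proof -
  have "id_blinfun \<in> Gs" using subgroup.one_closed[OF subgroup_Gs] by (simp add: GL_def)
  then show ?thesis unfolding orbit_def by force
qed

lemma orbit_mul: "x \<in> orbit Gs e \<Longrightarrow> y \<in> orbit Gs e \<Longrightarrow> x \<star> y \<in> orbit Gs e"
proof -
  assume x: "x \<in> orbit Gs e" and y: "y \<in> orbit Gs e"
  then have "mult_op x \<in> Gs" "mult_op y \<in> Gs" using Gs_eq by blast+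
  then have "mult_op x o\<^sub>L mult_op y \<in> Gs"
    using subgroup.m_closed[OF subgroup_Gs] by (simp add: GL_def)
  then show ?thesis unfolding orbit_def by (force simp: mul_def)
qed

lemma orbit_inverse:
  assumes x: "x \<in> orbit Gs e"
  shows "\<exists>y\<in>orbit Gs e. x \<star> y = e"
proof -
  interpret GL: group "GL :: ('a \<Rightarrow>\<^sub>L 'a) monoid" by (rule group_GL)
  have g: "mult_op x \<in> Gs" using x Gs_eq by blast
  have "inv\<^bsub>GL\<^esub> (mult_op x) \<in> Gs" using subgroup.m_inv_closed[OF subgroup_Gs g] .
  moreover have "mult_op x o\<^sub>L inv\<^bsub>GL\<^esub> (mult_op x) = id_blinfun"
    using GL.r_inv[of "mult_op x"] subgroup.mem_carrier[OF subgroup_Gs g] by (simp add: GL_def)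
  then have "x \<star> blinfun_apply (inv\<^bsub>GL\<^esub> (mult_op x)) e = e"
    by (metis blinfun_apply_blinfun_compose id_blinfun.rep_eq mul_def id_apply)
  ultimately show ?thesis unfolding orbit_def by blast
qed

lemma open_orbit: "open (orbit Gs e)"
  using open_subgroup_if_interior[OF e_in_orbit orbit_mul orbit_inverse interior_orbit] .

lemma sign_class_subset_orbit: "sign_class e \<subseteq> orbit Gs e"
  using identity_component_subset_open_subgroup[OF e_in_orbit orbit_mul orbit_inverse open_orbit] .

lemma orbit_subset_units: "orbit Gs e \<subseteq> units"
  using subgroup_subset_units[OF e_in_orbit orbit_mul orbit_inverse] .

text \<open>
  An endomorphism \<open>g\<close> is a multiplication iff it agrees with the multiplication by \<open>g e\<close>; in coordinates
  these are linear equations for \<open>g\<close>.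
\<close>

lemma zariski_closed_units: "zariski_closed_in_GL (mult_op ` units)"
proof -
  define P where "P = (\<lambda>(x, b) g. representation B (blinfun_apply g x - blinfun_apply (mult_op (blinfun_apply g e)) x) b)
    ` UNIV"
  obtain E :: "('a \<Rightarrow>\<^sub>L 'a) set" where "findim_space E"
    using findim_spaceE[OF findim_endomorphisms] .
  then interpret End: findim_space E .
  have lin: "linear (\<lambda>g. representation B (blinfun_apply g x - blinfun_apply (mult_op (blinfun_apply g e)) x) b)"
    for x b
    by (intro linearI)
       (simp_all add: linear_add[OF linear_coordinate] linear_scale[OF linear_coordinate]
         linear_diff[OF linear_coordinate] linear_add[OF linear_mult_op] linear_scale[OF linear_mult_op]
         blinfun.add_left blinfun.scaleR_left right_diff_distrib)
  have poly: "\<forall>p\<in>P. real_polynomial_function p"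
    unfolding P_def using End.linear_imp_bounded_linear[OF lin] by auto
  have "g \<in> mult_op ` units \<longleftrightarrow> g \<in> carrier GL \<and> (\<forall>p\<in>P. p g = 0)" for g
  proof
    assume "g \<in> mult_op ` units"
    then obtain x where "g = mult_op x" "x \<in> units" by blast
    then show "g \<in> carrier GL \<and> (\<forall>p\<in>P. p g = 0)"
      using mult_op_GL_iff linear_0[OF linear_coordinate] by (auto simp: P_def)
  next
    assume g: "g \<in> carrier GL \<and> (\<forall>p\<in>P. p g = 0)"
    have "g = mult_op (blinfun_apply g e)"
    proof (rule blinfun_eqI)
      fix x
      let ?d = "blinfun_apply g x - blinfun_apply (mult_op (blinfun_apply g e)) x"
      have "representation B ?d b = 0" for b using g by (auto simp: P_def)
      then have "?d = 0" using sum_coordinates[of ?d] by simp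
      then show "blinfun_apply g x = blinfun_apply (mult_op (blinfun_apply g e)) x" by simp
    qed
    then show "g \<in> mult_op ` units" using g mult_op_GL_iff by (metis imageI)
  qed
  then have "mult_op ` units = {g \<in> carrier GL. \<forall>p\<in>P. p g = 0}" by blast
  then show ?thesis unfolding zariski_closed_in_GL_def using poly by blast
qed

text \<open>
  A polynomial vanishing on \<open>Gs\<close> becomes, by composition with the linear map \<^term>\<open>mult_op\<close>, a
  polynomial on \<open>V\<close> that vanishes on the open orbit of \<open>e\<close>.
\<close>

lemma zariski_closure_Gs: "zariski_closure Gs = mult_op ` units"
  unfolding zariski_closure_def
proof (rule hull_unique)
  show "Gs \<subseteq> mult_op ` units"
    using Gs_eq orbit_subset_units by blast
  show "zariski_closed_in_GL (mult_op ` units)" by (rule zariski_closed_units)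
  fix Z assume Z: "Gs \<subseteq> Z" "zariski_closed_in_GL Z"
  then obtain P where P: "\<forall>p\<in>P. real_polynomial_function p" "Z = {g \<in> carrier GL. \<forall>p\<in>P. p g = 0}"
    by (auto simp: zariski_closed_in_GL_def)
  have "p (mult_op x) = 0" if p: "p \<in> P" for p x
  proof -
    have "real_polynomial_function (p \<circ> mult_op)"
      using P(1) p linear_imp_bounded_linear[OF linear_mult_op]
      by (intro real_polynomial_function_compose polynomial_function_bounded_linear) auto
    moreover have "(p \<circ> mult_op) y = 0" if "y \<in> orbit Gs e" for y
      using that Gs_eq Z(1) P(2) p by auto
    ultimately have "(p \<circ> mult_op) x = 0"
      using real_polynomial_vanishing_on_open open_orbit e_in_orbit by blast
    then show ?thesis by simp
  qed
  then show "mult_op ` units \<subseteq> Z" using P(2) mult_op_GL_iff by auto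
qed

text \<open>
  The map \<^term>\<open>mult_op\<close> and evaluation at \<open>e\<close> are continuous and inverse to each other, so components
  correspond.
\<close>

lemma component_of_zariski_closure:
  "connected_component_set (mult_op ` units) id_blinfun = mult_op ` sign_class e"
proof
  show "mult_op ` sign_class e \<subseteq> connected_component_set (mult_op ` units) id_blinfun"
  proof (rule connected_component_maximal)
    show "id_blinfun \<in> mult_op ` sign_class e"
      using sign_class_refl[OF e_in_units] mult_op_unit by force
    show "connected (mult_op ` sign_class e)"
      using connected_continuous_image[OF continuous_on_mult_op connected_sign_class[OF e_in_units]] .
    show "mult_op ` sign_class e \<subseteq> mult_op ` units" by (auto simp: sign_class_def)
  qed
  show "connected_component_set (mult_op ` units) id_blinfun \<subseteq> mult_op ` sign_class e"
  proof
    fix g assume "g \<in> connected_component_set (mult_op ` units) id_blinfun"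
    then obtain S where S: "connected S" "S \<subseteq> mult_op ` units" "id_blinfun \<in> S" "g \<in> S"
      by (auto simp: connected_component_def)
    have "(\<lambda>g. blinfun_apply g e) ` S \<subseteq> connected_component_set units e"
    proof (rule connected_component_maximal)
      show "e \<in> (\<lambda>g. blinfun_apply g e) ` S" using S(3) by force
      show "connected ((\<lambda>g. blinfun_apply g e) ` S)"
        using connected_continuous_image[OF continuous_on_evaluation S(1)] .
      show "(\<lambda>g. blinfun_apply g e) ` S \<subseteq> units" using S(2) by auto
    qed
    then have "blinfun_apply g e \<in> sign_class e"
      using S(4) component_of_units[OF e_in_units] by blast
    moreover have "g = mult_op (blinfun_apply g e)" using S(2,4) by auto
    ultimately show "g \<in> mult_op ` sign_class e" by blast
  qed
qed

text \<open>
  The elements whose multiplication preserves a given subspace form a subspace themselves, so a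
  spanning set of multiplications has the same invariant subspaces as the whole algebra.
\<close>

lemma invariant_subspace_iff_ideal:
  assumes P: "span P = UNIV"
  shows "invariant_subspace (mult_op ` P) W \<longleftrightarrow> is_ideal W"
proof
  assume inv: "invariant_subspace (mult_op ` P) W"
  then have W: "subspace W" by (simp add: invariant_subspace_def)
  have "y \<star> w \<in> W" if w: "w \<in> W" for y w
  proof -
    have "subspace {y. y \<star> w \<in> W}"
      using linear_subspace_vimage[OF linear_mul_right W] by (simp add: vimage_def)
    moreover have "P \<subseteq> {y. y \<star> w \<in> W}"
      using inv w by (auto simp: invariant_subspace_def mul_def)
    ultimately have "span P \<subseteq> {y. y \<star> w \<in> W}" using span_minimal by blast
    then show ?thesis using P by auto
  qed
  then show "is_ideal W" using W by (simp add: is_ideal_def)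
next
  assume "is_ideal W"
  then show "invariant_subspace (mult_op ` P) W"
    by (auto simp: invariant_subspace_def is_ideal_def mul_def)
qed

lemma maximal_invariant_subspace_iff:
  "maximal_invariant_subspace (mult_op ` sign_class e) W \<longleftrightarrow> maximal_ideal W"
  unfolding maximal_invariant_subspace_def maximal_ideal_def
  by (simp add: invariant_subspace_iff_ideal[OF span_sign_class])

lemma orbit_mult_op: "orbit (mult_op ` P) v = (\<lambda>y. y \<star> v) ` P"
  by (auto simp: orbit_def mul_def)

lemma orbit_sign_class: "v \<in> units \<Longrightarrow> orbit (mult_op ` sign_class e) v = sign_class v"
  by (simp add: orbit_mult_op sign_class_eq_coset)

text \<open>
  The orbit map is the restriction of evaluation at \<open>v\<close>, and its inverse that of \<open>u \<mapsto> mult_op (u \<star> w)\<close>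
  with \<open>w\<close> the inverse of \<open>v\<close>; both are linear.
\<close>

lemma orbit_map_analytic_diffeomorphism:
  assumes v: "v \<in> units"
  shows "analytic_diffeomorphism (\<lambda>g. blinfun_apply g v) (mult_op ` units) units"
proof -
  obtain w where w: "v \<star> w = e" "w \<star> v = e" "w \<in> units" using units_inverse[OF v] .
  have inj: "inj_on (\<lambda>g. blinfun_apply g v) (mult_op ` units)"
  proof (intro inj_onI, elim imageE)
    fix g h x y assume g: "g = mult_op x" and h: "h = mult_op y"
      and eq: "blinfun_apply g v = blinfun_apply h v"
    have "x \<star> v \<star> w = y \<star> v \<star> w" using eq by (simp add: g h mul_def)
    then show "g = h" by (simp add: g h assoc w(1))
  qed
  have right_inverse: "blinfun_apply (mult_op (u \<star> w)) v = u" for u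
    using w(2) by (simp add: assoc flip: mul_def)
  have image: "(\<lambda>g. blinfun_apply g v) ` mult_op ` units = units"
  proof
    show "(\<lambda>g. blinfun_apply g v) ` mult_op ` units \<subseteq> units"
      using units_mul v by (auto simp: mul_def)
    show "units \<subseteq> (\<lambda>g. blinfun_apply g v) ` mult_op ` units"
    proof
      fix u assume "u \<in> units"
      then have "mult_op (u \<star> w) \<in> mult_op ` units" using units_mul w(3) by blast
      then show "u \<in> (\<lambda>g. blinfun_apply g v) ` mult_op ` units"
        using right_inverse[of u] by (metis imageI)
    qed
  qed
  have "real_analytic_on (\<lambda>g. blinfun_apply g v) (mult_op ` units)"
    by (rule real_analytic_on_if_linear_extension[OF findim_endomorphisms])
       (auto simp: bounded_linear.linear blinfun.bounded_linear_left)
  moreover have "real_analytic_on (inv_into (mult_op ` units) (\<lambda>g. blinfun_apply g v)) units"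
  proof (rule real_analytic_on_if_linear_extension)
    show "\<exists>B::'a set. finite B \<and> span B = UNIV" using finite_B span_B by blast
    show "linear (\<lambda>u. mult_op (u \<star> w))"
      using linear_compose[OF linear_mul_right linear_mult_op] by (simp add: o_def)
    fix u assume "u \<in> units"
    then show "inv_into (mult_op ` units) (\<lambda>g. blinfun_apply g v) u = mult_op (u \<star> w)"
      using inv_into_f_eq[OF inj, of "mult_op (u \<star> w)" u] right_inverse units_mul w(3) by blast
  qed
  ultimately show ?thesis
    using inj image by (simp add: analytic_diffeomorphism_def bij_betw_def)
qed

lemma subgroup_mult_op_units: "subgroup (mult_op ` units) GL"
proof -
  interpret GL: group "GL :: ('a \<Rightarrow>\<^sub>L 'a) monoid" by (rule group_GL)
  show ?thesis
  proof (rule GL.subgroupI)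
    show "mult_op ` units \<subseteq> carrier GL" using mult_op_GL_iff by blast
    show "mult_op ` units \<noteq> {}" using e_in_units by blast
  next
    fix g assume "g \<in> mult_op ` units"
    then obtain x where x: "g = mult_op x" "x \<in> units" by blast
    obtain y where y: "x \<star> y = e" "y \<star> x = e" "y \<in> units" using units_inverse[OF x(2)] .
    have "mult_op y o\<^sub>L mult_op x = id_blinfun" using y(2) mult_op_mul[of y x] mult_op_unit by simp
    then have "inv\<^bsub>GL\<^esub> (mult_op x) = mult_op y"
      using mult_op_GL_iff x(2) y(3) by (intro GL.inv_equality) (auto simp: GL_def)
    then show "inv\<^bsub>GL\<^esub> g \<in> mult_op ` units" using x(1) y(3) by simp
  next
    fix g h assume "g \<in> mult_op ` units" "h \<in> mult_op ` units"
    then obtain x y where xy: "g = mult_op x" "h = mult_op y" "x \<in> units" "y \<in> units" by blast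
    then have "g \<otimes>\<^bsub>GL\<^esub> h = mult_op (x \<star> y)" by (simp add: mult_op_mul GL_def)
    then show "g \<otimes>\<^bsub>GL\<^esub> h \<in> mult_op ` units" using units_mul xy by blast
  qed
qed

text \<open>
  The signs of the real characters define a homomorphism onto \<open>(Z/2)^r\<close>. Its kernel is the identity
  component, and it is surjective since characters take prescribed values simultaneously.
\<close>

lemma component_group:
  fixes r :: nat
  assumes r: "r = card (Collect real_maximal)"
  shows "mult_op ` sign_class e \<lhd> GL\<lparr>carrier := mult_op ` units\<rparr>"
    and "(GL\<lparr>carrier := mult_op ` units\<rparr>) Mod (mult_op ` sign_class e)
      \<cong> product_group {1..r} (\<lambda>_. integer_mod_group 2)"
proof -
  let ?G = "GL\<lparr>carrier := mult_op ` units\<rparr>" and ?Z = "product_group {1..r} (\<lambda>_. integer_mod_group 2)"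
  have fin: "finite (Collect real_maximal)"
    by (rule finite_subset[OF _ finite_maximal]) (auto simp: real_maximal_def)
  obtain H where H: "bij_betw H {1..r} (Collect real_maximal)"
    using ex_bij_betw_nat_finite_1[OF fin] r by blast
  have Hi: "real_maximal (H i)" if "i \<in> {1..r}" for i
    using H that by (auto simp: bij_betw_def)
  define sg :: "('a \<Rightarrow>\<^sub>L 'a) \<Rightarrow> nat \<Rightarrow> int" where
    "sg g = (\<lambda>i\<in>{1..r}. if 0 < Re (chi (H i) (blinfun_apply g e)) then 0 else 1)" for g
  have "group ?G" using subgroup.subgroup_is_group[OF subgroup_mult_op_units group_GL] .
  moreover have "group ?Z" by (intro product_group) auto
  moreover have "sg \<in> hom ?G ?Z"
  proof (rule homI)
    fix g assume "g \<in> carrier ?G"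
    show "sg g \<in> carrier ?Z"
      by (auto simp: sg_def carrier_integer_mod_group)
  next
    fix g h assume "g \<in> carrier ?G" "h \<in> carrier ?G"
    then obtain x y where xy: "g = mult_op x" "h = mult_op y" "x \<in> units" "y \<in> units" by auto
    have gh: "blinfun_apply (g \<otimes>\<^bsub>?G\<^esub> h) e = x \<star> y"
      by (simp add: xy GL_def mul_def)
    show "sg (g \<otimes>\<^bsub>?G\<^esub> h) = sg g \<otimes>\<^bsub>?Z\<^esub> sg h"
    proof
      fix i
      show "sg (g \<otimes>\<^bsub>?G\<^esub> h) i = (sg g \<otimes>\<^bsub>?Z\<^esub> sg h) i"
      proof (cases "i \<in> {1..r}")
        case True
        note M = Hi[OF True]
        have "Re (chi (H i) x) \<noteq> 0" "Re (chi (H i) y) \<noteq> 0"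
          using xy(3,4) Re_chi_eq_0_iff[OF M] real_maximalD(1)[OF M] units_iff by blast+
        then show ?thesis
          using True unfolding sg_def gh
          by (auto simp: product_group_def Re_chi_mul[OF M] xy(1,2) zero_less_mult_iff)
      next
        case False
        then show ?thesis by (auto simp: sg_def product_group_def)
      qed
    qed
  qed
  ultimately interpret sg: group_hom ?G ?Z sg
    by (simp add: group_hom_def group_hom_axioms_def)
  have kernel: "kernel ?G ?Z sg = mult_op ` sign_class e"
  proof -
    have "sg (mult_op x) = \<one>\<^bsub>?Z\<^esub> \<longleftrightarrow> x \<in> sign_class e" if x: "x \<in> units" for x
    proof -
      have "sg (mult_op x) = \<one>\<^bsub>?Z\<^esub> \<longleftrightarrow> (\<forall>i\<in>{1..r}. 0 < Re (chi (H i) x))"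
        by (auto simp: sg_def product_group_def fun_eq_iff restrict_def split: if_splits)
      also have "\<dots> \<longleftrightarrow> (\<forall>M\<in>H ` {1..r}. 0 < Re (chi M x))" by blast
      also have "\<dots> \<longleftrightarrow> (\<forall>M. real_maximal M \<longrightarrow> 0 < Re (chi M x))"
        using H by (auto simp: bij_betw_def)
      also have "\<dots> \<longleftrightarrow> x \<in> sign_class e"
        using x real_maximalD(1) by (auto simp: sign_class_def)
      finally show ?thesis .
    qed
    then show ?thesis by (auto simp: kernel_def sign_class_def)
  qed
  have surj: "sg ` carrier ?G = carrier ?Z"
  proof
    show "sg ` carrier ?G \<subseteq> carrier ?Z" using sg.hom_closed by blast
    show "carrier ?Z \<subseteq> sg ` carrier ?G"
    proof
      fix s assume s: "s \<in> carrier ?Z"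
      define z :: "'a set \<Rightarrow> complex" where
        "z M = (if real_maximal M \<and> s (the_inv_into {1..r} H M) \<noteq> 0 then -1 else 1)" for M
      have "z M \<in> range (chi M)" if M: "maximal_ideal M" for M
      proof -
        have "chi M e = 1" "chi M (- e) = -1"
          using M by (simp_all add: linear_neg[OF chi_linear[OF M]])
        then have "1 \<in> range (chi M)" "-1 \<in> range (chi M)" by (metis rangeI)+
        then show ?thesis by (simp add: z_def)
      qed
      then obtain c where c: "\<And>M. maximal_ideal M \<Longrightarrow> chi M c = z M"
        using simultaneous_character_values by blast
      have cu: "c \<in> units" using c by (simp add: units_iff_chi z_def)
      have "sg (mult_op c) = s"
      proof
        fix i
        show "sg (mult_op c) i = s i"
        proof (cases "i \<in> {1..r}")
          case True
          have "the_inv_into {1..r} H (H i) = i"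
            using the_inv_into_f_f[OF bij_betw_imp_inj_on[OF H] True] .
          moreover have "s i \<in> {0..<2}"
            using s True by (auto simp: carrier_integer_mod_group)
          ultimately show ?thesis
            using True Hi[OF True] real_maximalD(1)[OF Hi[OF True]]
            by (auto simp: sg_def c z_def)
        next
          case False
          then show ?thesis using s by (auto simp: sg_def)
        qed
      qed
      then show "s \<in> sg ` carrier ?G" using cu by auto
    qed
  qed
  show "mult_op ` sign_class e \<lhd> ?G" using sg.normal_kernel kernel by simp
  show "?G Mod (mult_op ` sign_class e) \<cong> ?Z" using sg.FactGroup_iso[OF surj] kernel by simp
qed

text \<open>
  Multiplication by the imaginary unit commutes with \<open>Gs\<close>, so it is multiplication by an element whose
  square is \<open>-e\<close>; a real character would map it to a real square root of \<open>-1\<close>.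
\<close>

lemma complex_structure_no_real_maximal:
  assumes sc: "complex_structure sc"
    and lin: "\<And>h. h \<in> Gs \<Longrightarrow> Vector_Spaces.linear sc sc (blinfun_apply h)"
  shows "\<not> real_maximal M"
proof
  assume M: "real_maximal M"
  interpret sc: vector_space sc using sc by (simp add: complex_structure_def)
  have re: "sc (complex_of_real c) x = c *\<^sub>R x" for c x
    using sc by (simp add: complex_structure_def)
  have comm_Gs: "blinfun_apply h (sc \<i> x) = sc \<i> (blinfun_apply h x)" if "h \<in> Gs" for h x
    using lin[OF that] by (simp add: Vector_Spaces.linear_iff)
  have "linear (sc \<i>)"
  proof (rule linearI)
    fix x y :: 'a and c :: real
    show "sc \<i> (x + y) = sc \<i> x + sc \<i> y" by (rule sc.scale_right_distrib)
    show "sc \<i> (c *\<^sub>R x) = c *\<^sub>R sc \<i> x"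
      by (simp add: mult.commute flip: re)
  qed
  then have J: "blinfun_apply (Blinfun (sc \<i>)) = sc \<i>"
    by (intro bounded_linear_Blinfun_apply linear_imp_bounded_linear)
  have "Blinfun (sc \<i>) \<in> centralizer"
    unfolding centralizer_def using comm_Gs by (auto intro!: blinfun_eqI simp: J)
  then have "mult_op (sc \<i> e) = Blinfun (sc \<i>)" by (intro mult_op_eqI) (simp_all add: J)
  then have "sc \<i> e \<star> sc \<i> e = sc \<i> (sc \<i> e)" by (simp add: mul_def J)
  also have "\<dots> = - e" using re[of "-1" e] by simp
  finally have "Re (chi M (sc \<i> e)) * Re (chi M (sc \<i> e)) = Re (chi M (- e))"
    using Re_chi_mul[OF M] by metis
  then have "Re (chi M (sc \<i> e)) * Re (chi M (sc \<i> e)) = -1"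
    using real_maximalD(1)[OF M] by (simp add: linear_neg[OF chi_linear])
  then show False by (metis zero_le_square not_one_le_zero neg_0_le_iff_le)
qed

text \<open>
  A nonunit lies in a proper ideal, which contains its orbit but no nonempty open set.
\<close>

lemma open_orbit_imp_unit: "open (orbit Gs v) \<Longrightarrow> v \<in> units"
proof (rule ccontr)
  assume o: "open (orbit Gs v)" and "v \<notin> units"
  then obtain M where M: "maximal_ideal M" "v \<in> M" using units_iff by blast
  have "orbit Gs v \<subseteq> M"
    by (subst Gs_eq) (use M is_ideal_mul maximal_is_ideal in \<open>auto simp: orbit_mult_op\<close>)
  then have "span (orbit Gs v) \<subseteq> M"
    using span_minimal M(1) maximal_is_ideal is_ideal_subspace by blast
  moreover have "orbit Gs v \<noteq> {}"
    using e_in_orbit by (auto simp: orbit_def)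
  then have "span (orbit Gs v) = UNIV"
    using o span_eq_UNIV_if_interior[of "orbit Gs v"] by (simp add: interior_open)
  ultimately show False using M(1) by (auto simp: maximal_ideal_def)
qed

end

section \<open>The structure theorem\<close>

theorem theorem4p1:
  fixes Gs G G0 :: "('a::real_normed_vector \<Rightarrow>\<^sub>L 'a) set"
    and Hs H1 H2 :: "'a set set" and U :: "'a set" and r d :: nat
  assumes findim: "\<exists>B::'a set. finite B \<and> span B = UNIV"
    and subgr: "subgroup Gs GL"
    and abel: "comm_group (GL\<lparr>carrier := Gs\<rparr>)"
    and inner_pt: "\<exists>v::'a. interior (orbit Gs v) \<noteq> {}"
    and G_eq: "G = zariski_closure Gs"
    and G0_eq: "G0 = connected_component_set G id_blinfun"
    and Hs_eq: "Hs = {W. maximal_invariant_subspace G0 W}"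
    and H1_eq: "H1 = {W \<in> Hs. codim W = 1}"
    and H2_eq: "H2 = {W \<in> Hs. codim W = 2}"
    and r_eq: "r = card H1"
    and d_eq: "d = card Hs"
    and U_eq: "U = UNIV - \<Union>Hs"
  shows
    "(\<comment> \<open>(1)\<close>
      subgroup Gs (GL\<lparr>carrier := G\<rparr>) \<and> openin (top_of_set G) Gs \<and> G0 \<subseteq> Gs) \<and>
     (\<comment> \<open>(2)\<close>
      finite Hs \<and> (\<forall>W\<in>Hs. invariant_subspace G W) \<and> Hs = H1 \<union> H2 \<and>
      r + 2 * (d - r) \<le> dim (UNIV :: 'a set)) \<and>
     (\<comment> \<open>(3)\<close>
      \<forall>v\<in>U. analytic_diffeomorphism (\<lambda>g. blinfun_apply g v) G U) \<and>
     (\<comment> \<open>(4)\<close>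
      G0 \<lhd> (GL\<lparr>carrier := G\<rparr>) \<and>
      ((GL\<lparr>carrier := G\<rparr>) Mod G0) \<cong> (product_group {1..r} (\<lambda>_. integer_mod_group 2)) \<and>
      (\<forall>v\<in>U. orbit G0 v = connected_component_set U v \<and>
        (\<forall>H\<in>H1. \<exists>!C. C \<in> open_half_spaces H \<and> v \<in> C) \<and>
        closure (orbit G0 v)
          = (\<Inter>H\<in>H1. closure (THE C. C \<in> open_half_spaces H \<and> v \<in> C)))) \<and>
     (\<comment> \<open>(5)\<close>
      (\<exists>sc. complex_structure sc \<and>
          (\<forall>h\<in>Gs. Vector_Spaces.linear sc sc (blinfun_apply h))) \<longrightarrow>
        r = 0 \<and> connected G \<and> G0 = Gs \<and> Gs = G \<and>
        {X. (\<exists>v. X = orbit Gs v) \<and> open X} = {U} \<and> closure U = UNIV)"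
proof -
  obtain B :: "'a set" where "findim_space B" using findim_spaceE[OF findim] .
  then interpret findim_space B .
  obtain e where e: "interior (orbit Gs e) \<noteq> {}" using inner_pt by blast
  have "g o\<^sub>L h = h o\<^sub>L g" if "g \<in> Gs" "h \<in> Gs" for g h
    using comm_monoid.m_comm[OF comm_group.axioms(1)[OF abel]] that by (simp add: GL_def)
  then interpret abelian_group_with_open_orbit B Gs e
    by (intro abelian_group_with_open_orbit.intro abelian_group_with_open_orbit_axioms.intro
        findim_space_axioms subgr e)
  have G: "G = mult_op ` units" using G_eq zariski_closure_Gs by simp
  have G0: "G0 = mult_op ` sign_class e" using G0_eq G component_of_zariski_closure by simp
  have Hs: "Hs = Collect maximal_ideal"
    using Hs_eq G0 maximal_invariant_subspace_iff by auto
  have H1: "H1 = Collect real_maximal"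
    using H1_eq Hs by (auto simp: real_maximal_def)
  have U: "U = units" using U_eq Hs by (auto simp: units_iff)
  have Hs_split: "Hs = H1 \<union> H2"
    using Hs H1_eq H2_eq codim_maximal by auto
  have dim_bound: "r + 2 * (d - r) \<le> dim (UNIV :: 'a set)"
  proof -
    have fin: "finite H1" "finite H2" using finite_maximal Hs H1_eq H2_eq by simp_all
    have disj: "H1 \<inter> H2 = {}" using H1_eq H2_eq by auto
    have "(\<Sum>M\<in>Hs. codim M) = (\<Sum>M\<in>H1. codim M) + (\<Sum>M\<in>H2. codim M)"
      unfolding Hs_split by (rule sum.union_disjoint[OF fin disj])
    also have "\<dots> = r + 2 * card H2" using H1_eq H2_eq r_eq by simp
    also have "card H2 = d - r"
      using card_Un_disjoint[OF fin disj] Hs_split r_eq d_eq by simp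
    finally show ?thesis
      using sum_codim_maximal[of Hs] finite_maximal Hs by simp
  qed
  have part1: "subgroup Gs (GL\<lparr>carrier := G\<rparr>) \<and> openin (top_of_set G) Gs \<and> G0 \<subseteq> Gs"
  proof (intro conjI)
    have Gs_G: "Gs \<subseteq> G" using Gs_eq G orbit_subset_units by blast
    show "subgroup Gs (GL\<lparr>carrier := G\<rparr>)"
      using group.subgroup_incl[OF group_GL subgr] subgroup_mult_op_units Gs_G G by simp
    have "Gs = G \<inter> (\<lambda>g. blinfun_apply g e) -` orbit Gs e"
    proof
      show "Gs \<subseteq> G \<inter> (\<lambda>g. blinfun_apply g e) -` orbit Gs e"
        using Gs_G by (auto simp: orbit_def)
      show "G \<inter> (\<lambda>g. blinfun_apply g e) -` orbit Gs e \<subseteq> Gs"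
        by (subst (2) Gs_eq) (auto simp: G)
    qed
    moreover have "open ((\<lambda>g. blinfun_apply g e) -` orbit Gs e)"
      using open_vimage[OF open_orbit continuous_on_evaluation] .
    ultimately show "openin (top_of_set G) Gs"
      by (metis openin_open_Int)
    show "G0 \<subseteq> Gs" using G0 Gs_eq sign_class_subset_orbit by blast
  qed
  have part2: "finite Hs \<and> (\<forall>W\<in>Hs. invariant_subspace G W) \<and> Hs = H1 \<union> H2 \<and>
      r + 2 * (d - r) \<le> dim (UNIV :: 'a set)"
  proof (intro conjI ballI dim_bound Hs_split)
    show "finite Hs" using finite_maximal Hs by simp
    have "sign_class e \<subseteq> units" by (auto simp: sign_class_def)
    then have "span units = UNIV" using span_sign_class span_mono by blast
    then show "invariant_subspace G W" if "W \<in> Hs" for W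
      using that Hs G invariant_subspace_iff_ideal maximal_is_ideal by simp
  qed
  have part3: "\<forall>v\<in>U. analytic_diffeomorphism (\<lambda>g. blinfun_apply g v) G U"
    using orbit_map_analytic_diffeomorphism U G by simp
  have orbit_G0: "orbit G0 v = sign_class v" if "v \<in> U" for v
    using that orbit_sign_class U G0 by simp
  have part4: "G0 \<lhd> (GL\<lparr>carrier := G\<rparr>) \<and>
      ((GL\<lparr>carrier := G\<rparr>) Mod G0) \<cong> (product_group {1..r} (\<lambda>_. integer_mod_group 2)) \<and>
      (\<forall>v\<in>U. orbit G0 v = connected_component_set U v \<and>
        (\<forall>H\<in>H1. \<exists>!C. C \<in> open_half_spaces H \<and> v \<in> C) \<and>
        closure (orbit G0 v)
          = (\<Inter>H\<in>H1. closure (THE C. C \<in> open_half_spaces H \<and> v \<in> C)))"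
  proof (intro conjI ballI)
    show "G0 \<lhd> (GL\<lparr>carrier := G\<rparr>)"
      and "((GL\<lparr>carrier := G\<rparr>) Mod G0) \<cong> (product_group {1..r} (\<lambda>_. integer_mod_group 2))"
      using component_group[of r] r_eq H1 G G0 by simp_all
    fix v assume v: "v \<in> U"
    then have vu: "v \<in> units" using U by simp
    show "orbit G0 v = connected_component_set U v"
      using orbit_G0[OF v] component_of_units[OF vu] U by simp
    show "\<exists>!C. C \<in> open_half_spaces H \<and> v \<in> C" if "H \<in> H1" for H
      using halfspaces_of_real_maximal(1)[OF _ vu] that H1 by simp
    have "closure (orbit G0 v) = (\<Inter>H\<in>H1. {x. 0 \<le> Re (chi H x) * Re (chi H v)})"
      using orbit_G0[OF v] closure_sign_class[OF vu] H1 by auto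
    also have "\<dots> = (\<Inter>H\<in>H1. closure (THE C. C \<in> open_half_spaces H \<and> v \<in> C))"
      using halfspaces_of_real_maximal(2)[OF _ vu] H1 by simp
    finally show "closure (orbit G0 v)
          = (\<Inter>H\<in>H1. closure (THE C. C \<in> open_half_spaces H \<and> v \<in> C))" .
  qed
  have part5: "r = 0 \<and> connected G \<and> G0 = Gs \<and> Gs = G \<and>
        {X. (\<exists>v. X = orbit Gs v) \<and> open X} = {U} \<and> closure U = UNIV"
    if "\<exists>sc. complex_structure sc \<and> (\<forall>h\<in>Gs. Vector_Spaces.linear sc sc (blinfun_apply h))"
  proof -
    have none: "\<not> real_maximal M" for M
      using that complex_structure_no_real_maximal by blast
    then have H1_empty: "H1 = {}" using H1 by simp
    have all: "sign_class v = units" for v using none by (auto simp: sign_class_def)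
    have G0_G: "G0 = G" using G0 G all by simp
    have Gs_G: "Gs = G"
      using part1 G0_G subgroup.subset[of Gs "GL\<lparr>carrier := G\<rparr>"] by auto
    have orb: "orbit Gs v = U" if "v \<in> U" for v
      using orbit_G0[OF that] all U G0_G Gs_G by simp
    have "connected G" using G0_G G0_eq connected_connected_component by metis
    moreover have "{X. (\<exists>v. X = orbit Gs v) \<and> open X} = {U}"
    proof -
      have "e \<in> U" using U e_in_units by simp
      then show ?thesis
        using orb open_orbit_imp_unit open_units U by auto
    qed
    moreover have "closure U = UNIV"
      using closure_sign_class[OF e_in_units] all none U by simp
    ultimately show ?thesis using H1_empty r_eq G0_G Gs_G by simp
  qed
  from part1 part2 part3 part4 part5 show ?thesis by blast
qed

end
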